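(* Let $p$ be a prime, and let $d$ and $t$ be positive integers. Assume that $x_1^{k_1}x_2^{k_2}\cdots x_{p^t}^{k_{p^t}}$ is the cycle type of a complete mapping of the additive group $\mathbb{F}_p^t$. For $\ell=1,2,\ldots,p^t$ and $i=1,2,\ldots,k_{\ell}$, let $\gamma_{\ell,i}\in\Gamma(d,p,\ell)$. Then for every $d$-dimensional $\mathbb{F}_p$-subspace $W$ of $\mathbb{F}_p^{d+t}$, the $\mathbb{F}_p$-vector space $\mathbb{F}_p^{d+t}$ admits a $W$-coset-wise $\mathbb{F}_p$-affine complete mapping whose cycle type is \[ \prod_{\ell=1}^{p^t}\prod_{i=1}^{k_{\ell}}\operatorname{BU}_{\ell}(\gamma_{\ell,i}). \]
   Context: A complete mapping of an additive group $G$ is a permutation $f$ of $G$ such that $x\mapsto f(x)+x$ is also a permutation of $G$. The cycle type $\operatorname{CT}(\sigma)$ of a permutation $\sigma$ of a finite set $\Omega$ is the monomial $x_1^{k_1}x_2^{k_2}\cdots x_{|\Omega|}^{k_{|\Omega|}}\in\mathbb{Q}[x_n:n\geq1]$, where $k_\ell$ is the number of cycles of length $\ell$ of $\sigma$; for a set $X$ of permutations, $\operatorname{CT}(X)=\{\operatorname{CT}(\sigma):\sigma\in X\}$. For a positive integer $\ell$, $\operatorname{BU}_\ell$ is the unique $\mathbb{Q}$-algebra endomorphism of $\mathbb{Q}[x_n:n\geq1]$ with $\operatorname{BU}_\ell(x_n)=x_{\ell n}$ for all $n\geq1$. Vectors in $\mathbb{F}_p^d$ are row vectors. For a $(d\times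 d)$-matrix $M$ over $\mathbb{F}_p$ and $v\in\mathbb{F}_p^d$, $\lambda(M,v)$ denotes the map $\mathbb{F}_p^d\to\mathbb{F}_p^d$, $x\mapsto xM+v$. $\operatorname{AGL}_d(p)=\{\lambda(M,v): M\in\operatorname{GL}_d(p), v\in\mathbb{F}_p^d\}$. $\operatorname{CGL}_d(p)$ is the set of matrices $A\in\operatorname{GL}_d(p)$ that do not have $-1$ as an eigenvalue, and $\operatorname{ACGL}_d(p)=\{\lambda(A,v):A\in\operatorname{CGL}_d(p),v\in\mathbb{F}_p^d\}$. Define \[ \Gamma(d,p,\ell)=\begin{cases}\operatorname{CT}(\operatorname{ACGL}_d(p)), & \ell=1,\\ \operatorname{CT}(\operatorname{AGL}_d(p)), & \ell\geq2,\ (d,p)\notin\{(1,2),(1,3),(2,2)\},\\ \emptyset, & \ell\geq2,\ (d,p)=(1,2),\\ \{x_1^3,x_3\}, & \ell\ge2,\ (d,p)=(1,3),\\ \{x_1^4,x_2^2,x_1x_3\}, & \ell\geq 2,\ (d,p)=(2,2).\end{cases} \] For a field $K$, a $K$-vector space $V$ and a subspace $W$, a function $f:V\to V$ is $W$-coset-wise $K$-affine if for each coset $C$ of $W$ in $V$ there are $v_C\in V$ and a $K$-linear endomorphism $\varphi_C$ of $V$ with $\varphi_C(W)\subseteq W$ such that $f(x)=\varphi_C(x)+v_C$ for all $x\in C$. *)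

theory Defs
  imports "HOL-Analysis.Analysis" "HOL-Library.Multiset" "Berlekamp_Zassenhaus.Finite_Field"
begin

text \<open>A monomial x_1^k_1 x_2^k_2 ... of Q[x_n : n >= 1] is represented by the multiset of
  positive integers in which n occurs with multiplicity k_n.  Products of monomials are
  multiset sums.\<close>

definition orbit_of :: "('a \<Rightarrow> 'a) \<Rightarrow> 'a \<Rightarrow> 'a set" where
  "orbit_of f x = {(f ^^ n) x | n. True}"

text \<open>Cycle type of a permutation f of a finite set Omega: multiset of cycle lengths.\<close>
definition cycle_type :: "('a \<Rightarrow> 'a) \<Rightarrow> 'a set \<Rightarrow> nat multiset" where
  "cycle_type f \<Omega> = image_mset card (mset_set {orbit_of f x | x. x \<in> \<Omega>})"

text \<open>BU_l : x_n |-> x_{l n}.\<close>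
definition BU :: "nat \<Rightarrow> nat multiset \<Rightarrow> nat multiset" where
  "BU l m = image_mset (\<lambda>n. l * n) m"

text \<open>Complete mapping of the additive group F_p^t (here the type 'a).\<close>
definition complete_mapping :: "('a::ab_group_add \<Rightarrow> 'a) \<Rightarrow> bool" where
  "complete_mapping f \<longleftrightarrow> bij f \<and> bij (\<lambda>x. f x + x)"

text \<open>lambda(M,v): x |-> xM + v, with row vectors.\<close>
definition lam :: "'a::field ^'n^'n \<Rightarrow> 'a^'n \<Rightarrow> 'a^'n \<Rightarrow> 'a^'n" where
  "lam M v = (\<lambda>x. x v* M + v)"

definition AGL :: "(('a::field^'n) \<Rightarrow> 'a^'n) set" where
  "AGL = {lam M v | M v. invertible M}"

definition CGL :: "('a::field^'n^'n) set" where
  "CGL = {A. invertible A \<and> \<not> (\<exists>x. x \<noteq> 0 \<and> x v* A = - x)}"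

definition ACGL :: "(('a::field^'n) \<Rightarrow> 'a^'n) set" where
  "ACGL = {lam A v | A v. A \<in> CGL}"

definition CTset :: "('a \<Rightarrow> 'a) set \<Rightarrow> nat multiset set" where
  "CTset X = (\<lambda>\<sigma>. cycle_type \<sigma> UNIV) ` X"

text \<open>Gamma(d,p,l), with F_p^d given as the type ('p mod_ring)^'d, d = CARD('d), p = CARD('p).\<close>
definition Gamma :: "('p::prime_card mod_ring ^ 'd) itself \<Rightarrow> nat \<Rightarrow> nat multiset set" where
  "Gamma _ l =
    (if l = 1 then CTset (ACGL :: (('p mod_ring^'d) \<Rightarrow> _) set)
     else if CARD('d) = 1 \<and> CARD('p) = 2 then {}
     else if CARD('d) = 1 \<and> CARD('p) = 3 then {{#1,1,1#}, {#3#}}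
     else if CARD('d) = 2 \<and> CARD('p) = 2 then {{#1,1,1,1#}, {#2,2#}, {#1,3#}}
     else CTset (AGL :: (('p mod_ring^'d) \<Rightarrow> _) set))"

text \<open>W-coset-wise K-affine.\<close>
definition coset_wise_affine :: "('a::field^'n) set \<Rightarrow> ('a^'n \<Rightarrow> 'a^'n) \<Rightarrow> bool" where
  "coset_wise_affine W f \<longleftrightarrow>
     (\<forall>C \<in> {(\<lambda>w. x + w) ` W | x. True}. \<exists>v \<phi>.
        Vector_Spaces.linear (*s) (*s) \<phi> \<and> \<phi> ` W \<subseteq> W \<and> (\<forall>y\<in>C. f y = \<phi> y + v))"

end

theory Submission
  imports Defs
begin

text \<open>Write \<open>F\<^sub>p\<^sup>d\<^sup>+\<^sup>t = W \<oplus> U\<close> with \<open>U \<cong> F\<^sub>p\<^sup>t\<close> and put \<open>g (w + u) = A\<^sub>u w + f u\<close> with all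
  \<open>A\<^sub>u\<close> in ACGL. Then \<open>g\<close> is a complete mapping, and over a cycle of \<open>f\<close> of length \<open>l\<close> its cycle
  type is \<open>BU\<^sub>l\<close> of the cycle type of the composition of the \<open>A\<^sub>u\<close> along that cycle, because this
  composition is the first return map to a fibre. So one has to factor the linear part \<open>M\<close> of
  an affine map into \<open>l\<close> matrices of CGL, and \<open>l = 2\<close> is the essential case: \<open>M = A (A\<^sup>-\<^sup>1 M)\<close> is such
  a factorization iff \<open>A\<close>, \<open>A + 1\<close> and \<open>A + M\<close> are all invertible.

  More generally, given linear maps \<open>B, C : V \<rightarrow> U\<close> between spaces of equal dimension \<open>n\<close>, one looks
  for \<open>A\<close> such that \<open>A\<close>, \<open>A + B\<close> and \<open>A + C\<close> are injective. If \<open>p \<ge> 5\<close> or \<open>n \<ge> 3\<close>, there are \<open>y \<in> V\<close>, a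
  coordinate \<open>j\<close> and a value \<open>A y\<close> for which the \<open>j\<close>-th coordinates of \<open>A y\<close>, \<open>(A + B) y\<close> and \<open>(A + C) y\<close>
  are nonzero, and passing to Schur complements reduces \<open>n\<close> to \<open>n - 1\<close>. The remaining base cases
  \<open>p = 3, n = 2\<close> and \<open>p = 2, n = 3\<close> are finite: choose bases in which \<open>B\<close> is \<open>diag(1,...,1,0,...,0)\<close> and
  run through all matrices of \<open>C\<close>.\<close>

section \<open>Separating linear maps\<close>

abbreviation vlin :: "('a::field ^ 'm \<Rightarrow> 'a ^ 'n) \<Rightarrow> bool" where
  "vlin \<equiv> Vector_Spaces.linear (*s) (*s)"

lemma vlin_iff: "vlin f \<longleftrightarrow> (\<forall>x y. f (x + y) = f x + f y) \<and> (\<forall>c x. f (c *s x) = c *s f x)"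
  unfolding Vector_Spaces.linear_iff by (simp add: vec.vector_space_axioms)

lemma vlinI: "(\<And>x y. f (x + y) = f x + f y) \<Longrightarrow> (\<And>c x. f (c *s x) = c *s f x) \<Longrightarrow> vlin f"
  by (simp add: vlin_iff)

section \<open>Linear functionals on a subspace and their kernels\<close>

definition functional :: "('a::field ^ 'n \<Rightarrow> 'a) \<Rightarrow> bool" where
  "functional \<eta> \<longleftrightarrow> (\<forall>x y. \<eta> (x + y) = \<eta> x + \<eta> y) \<and> (\<forall>c x. \<eta> (c *s x) = c * \<eta> x)"

lemma functional_add: "functional \<eta> \<Longrightarrow> \<eta> (x + y) = \<eta> x + \<eta> y"
  and functional_scale: "functional \<eta> \<Longrightarrow> \<eta> (c *s x) = c * \<eta> x"
  by (simp_all add: functional_def)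

lemma functional_0: "functional \<eta> \<Longrightarrow> \<eta> 0 = 0"
  using functional_scale[of \<eta> 0 0] by simp

lemma functional_diff: "functional \<eta> \<Longrightarrow> \<eta> (x - y) = \<eta> x - \<eta> y"
  using functional_add[of \<eta> "x - y" y] by simp

lemma functional_sum: "functional \<eta> \<Longrightarrow> \<eta> (\<Sum>i\<in>I. g i) = (\<Sum>i\<in>I. \<eta> (g i))"
  by (induction I rule: infinite_finite_induct) (simp_all add: functional_0 functional_add)

lemma functional_component: "vlin B \<Longrightarrow> functional (\<lambda>x. B x $ j)"
  by (simp add: functional_def vlin_iff)

lemma subspace_kernel_on:
  assumes "vec.subspace V" "functional \<eta>"
  shows "vec.subspace {x\<in>V. \<eta> x = 0}"
  using assms by (auto simp: vec.subspace_def functional_0 functional_add functional_scale)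

text \<open>Subtracting \<open>\<eta> x / \<eta> y\<close> times \<open>y\<close> moves any
  \<open>x\<close> in \<open>V\<close> into the kernel, so the kernel and \<open>y\<close> span
  \<open>V\<close>, while \<open>y\<close> itself is not in the kernel.\<close>

lemma dim_kernel_on:
  assumes V: "vec.subspace V" and \<eta>: "functional \<eta>" and y: "y \<in> V" "\<eta> y \<noteq> 0"
  shows "vec.dim V = Suc (vec.dim {x\<in>V. \<eta> x = 0})"
proof -
  let ?K = "{x\<in>V. \<eta> x = 0}"
  have K: "vec.subspace ?K" by (rule subspace_kernel_on[OF V \<eta>])
  have "vec.span (insert y ?K) = V"
  proof
    have "insert y ?K \<subseteq> V" using y by auto
    then show "vec.span (insert y ?K) \<subseteq> V" by (rule vec.span_minimal[OF _ V])
    show "V \<subseteq> vec.span (insert y ?K)"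
    proof
      fix x assume x: "x \<in> V"
      let ?c = "\<eta> x / \<eta> y"
      have "x - ?c *s y \<in> ?K"
        using x y V by (simp add: functional_diff[OF \<eta>] functional_scale[OF \<eta>] vec.subspace_diff vec.subspace_scale)
      then have "x - ?c *s y \<in> vec.span (insert y ?K)" by (auto intro: vec.span_base)
      moreover have "?c *s y \<in> vec.span (insert y ?K)" by (auto intro: vec.span_base vec.span_scale)
      ultimately show "x \<in> vec.span (insert y ?K)" using vec.span_add by fastforce
    qed
  qed
  moreover have "y \<notin> vec.span ?K" using y(2) by (simp add: vec.span_eq_iff[THEN iffD2, OF K])
  ultimately show ?thesis using vec.dim_insert[of y ?K] by (metis Suc_eq_plus1 vec.dim_span)
qed

lemma dim_kernel_on_ge:
  assumes V: "vec.subspace V" and \<eta>: "functional \<eta>"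
  shows "vec.dim V \<le> Suc (vec.dim {x\<in>V. \<eta> x = 0})"
proof (cases "\<exists>y\<in>V. \<eta> y \<noteq> 0")
  case True
  then show ?thesis using dim_kernel_on[OF V \<eta>] by auto
next
  case False
  then have "{x\<in>V. \<eta> x = 0} = V" by auto
  then show ?thesis by simp
qed

lemma dim_pos_obtains:
  fixes V :: "('a::field^'n) set"
  assumes "vec.dim V \<noteq> 0" "vec.subspace V"
  obtains y j where "y \<in> V" "y $ j \<noteq> 0"
proof -
  from assms obtain y where "y \<in> V" "y \<noteq> 0" by auto
  then show thesis using that by (auto simp: vec_eq_iff)
qed

text \<open>Both subspaces lie in one fixed ambient space, so that the induction on the dimension
  can replace them by hyperplanes without changing the type.\<close>

definition separable :: "('a::field ^ 'n) set \<Rightarrow> ('a ^ 'n) set \<Rightarrow> ('a ^ 'n \<Rightarrow> 'a ^ 'n) \<Rightarrow> ('a ^ 'n \<Rightarrow> 'a ^ 'n) \<Rightarrow> bool" where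
  "separable V U B C \<longleftrightarrow> (\<exists>A. vlin A \<and> A ` V \<subseteq> U \<and>
     (\<forall>v\<in>V. v \<noteq> 0 \<longrightarrow> A v \<noteq> 0 \<and> A v + B v \<noteq> 0 \<and> A v + C v \<noteq> 0))"

definition separable_dim :: "('a::field ^ 'n) itself \<Rightarrow> nat \<Rightarrow> bool" where
  "separable_dim _ n \<longleftrightarrow> (\<forall>V U :: ('a ^ 'n) set. \<forall>B C. vec.subspace V \<and> vec.subspace U \<and> vec.dim V = n \<and> vec.dim U = n
     \<and> vlin B \<and> vlin C \<and> B ` V \<subseteq> U \<and> C ` V \<subseteq> U \<longrightarrow> separable V U B C)"

text \<open>Prescribe \<open>A y = w\<close>. The three maps then send \<open>y\<close> to
  \<open>w\<close>, \<open>w + B y\<close> and \<open>w + C y\<close>, each of which spans a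
  complement of \<open>U'\<close> in \<open>U\<close>. Projecting onto \<open>U'\<close> along these
  vectors leaves a problem of dimension \<open>n\<close> on \<open>V'\<close>, and its solution
  \<open>A'\<close> extends to \<open>A\<close>.\<close>

lemma separable_step:
  fixes V U :: "('a::field ^ 'n) set"
  assumes P: "separable_dim TYPE('a^'n) n"
    and V: "vec.subspace V" "vec.dim V = Suc n" and U: "vec.subspace U" "vec.dim U = Suc n"
    and B: "vlin B" "B ` V \<subseteq> U" and C: "vlin C" "C ` V \<subseteq> U"
    and y: "y \<in> V" "y $ k \<noteq> 0" and w: "w \<in> U" "w $ j \<noteq> 0" "(w + B y) $ j \<noteq> 0" "(w + C y) $ j \<noteq> 0"
  shows "separable V U B C"
proof -
  define V' where "V' = {x\<in>V. x $ k = 0}"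
  define U' where "U' = {x\<in>U. x $ j = 0}"
  have fk: "functional (\<lambda>x::'a^'n. x $ i)" for i by (simp add: functional_def)
  have V': "vec.subspace V'" "vec.dim V' = n"
    using subspace_kernel_on[OF V(1) fk] dim_kernel_on[OF V(1) fk y] V(2) by (simp_all add: V'_def)
  have U': "vec.subspace U'" "vec.dim U' = n"
    using subspace_kernel_on[OF U(1) fk] dim_kernel_on[OF U(1) fk w(1,2)] U(2) by (simp_all add: U'_def)
  \<comment> \<open>\<open>red D\<close> is the Schur complement of \<open>D\<close>: it projects onto \<open>U'\<close> along \<open>w + D y\<close>.\<close>
  define red where "red D x = D x - (D x $ j / (w + D y) $ j) *s (w + D y)" for D :: "'a^'n \<Rightarrow> 'a^'n" and x
  have red: "vlin (red D)" "red D ` V' \<subseteq> U'" if "vlin D" "D ` V \<subseteq> U" "(w + D y) $ j \<noteq> 0" for D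
  proof -
    show "vlin (red D)" using that(1) unfolding red_def
      by (intro vlinI) (simp_all add: vlin_iff vec_eq_iff add_divide_distrib algebra_simps)
    have "red D x $ j = D x $ j - (D x $ j / (w + D y) $ j) * (w + D y) $ j" for x
      by (simp only: red_def vector_minus_component vector_smult_component)
    then have "red D x $ j = 0" for x using that(3) by simp
    moreover have "red D x \<in> U" if "x \<in> V" for x
      unfolding red_def using that \<open>D ` V \<subseteq> U\<close> y(1) w(1) U(1)
      by (intro vec.subspace_diff vec.subspace_scale vec.subspace_add) auto
    ultimately have "red D x \<in> U'" if "x \<in> V'" for x
      using that by (simp add: U'_def V'_def)
    then show "red D ` V' \<subseteq> U'" by auto
  qed
  have "separable V' U' (red B) (red C)"
    by (rule P[unfolded separable_dim_def, rule_format]) (use V' U' red[OF B w(3)] red[OF C w(4)] in simp)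
  then obtain A' where A': "vlin A'" "A' ` V' \<subseteq> U'"
    and A'0: "\<forall>v\<in>V'. v \<noteq> 0 \<longrightarrow> A' v \<noteq> 0 \<and> A' v + red B v \<noteq> 0 \<and> A' v + red C v \<noteq> 0"
    unfolding separable_def by (elim exE conjE)
  \<comment> \<open>\<open>x $ k / y $ k\<close> is the coefficient of \<open>y\<close> when
    \<open>x\<close> is decomposed along \<open>V'\<close>; thus \<open>A\<close> extends
    \<open>A'\<close> and sends \<open>y\<close> to \<open>w\<close>.\<close>
  define A where "A x = A' (x - (x $ k / y $ k) *s y) + (x $ k / y $ k) *s w" for x
  have linA: "vlin A"
    unfolding A_def using A'(1)
    by (intro vlinI) (simp_all add: vec.linear_diff vec.linear_add vec.linear_scale add_divide_distrib
        vec.scale_right_distrib vec.scale_left_distrib vec.scale_right_diff_distrib)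
  have dec: "x - (x $ k / y $ k) *s y \<in> V'" if "x \<in> V" for x
    using that y V(1) by (auto simp: V'_def intro!: vec.subspace_diff vec.subspace_scale)
  have AU: "A ` V \<subseteq> U"
    using dec A'(2) w(1) U(1) unfolding A_def U'_def
    by (auto intro!: vec.subspace_add vec.subspace_scale)
  \<comment> \<open>One argument for the three cases \<open>D = 0\<close>, \<open>D = B\<close> and
    \<open>D = C\<close>.\<close>
  have key: "x = 0" if x: "x \<in> V" and z: "A x + D x = 0" and D: "vlin D" "(w + D y) $ j \<noteq> 0"
    and D0: "\<And>v. v \<in> V' \<Longrightarrow> v \<noteq> 0 \<Longrightarrow> A' v + red D v \<noteq> 0" for x D
  proof -
    define c where "c = x $ k / y $ k"
    define x' where "x' = x - c *s y"
    have x': "x' \<in> V'" using dec[OF x] by (simp add: x'_def c_def)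
    have "D x = D x' + c *s D y" by (simp add: x'_def vec.linear_diff[OF D(1)] vec.linear_scale[OF D(1)])
    then have e: "A' x' + D x' + c *s (w + D y) = 0"
      using z unfolding A_def c_def[symmetric] x'_def[symmetric] by (simp add: vec.scale_right_distrib ac_simps)
    \<comment> \<open>\<open>A' x'\<close> has \<open>j\<close>-th coordinate 0, so this coordinate
      forces \<open>c\<close> to be minus the coefficient in \<open>red\<close>, and the equation
      becomes \<open>A' x' + red D x' = 0\<close>.\<close>
    then have "(A' x' + D x' + c *s (w + D y)) $ j = 0" by simp
    moreover have "A' x' $ j = 0" using x' A'(2) by (auto simp: U'_def)
    ultimately have "D x' $ j + c * (w + D y) $ j = 0" by (simp add: distrib_left)
    then have "c * (w + D y) $ j = - D x' $ j" by (metis add.commute eq_neg_iff_add_eq_0)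
    then have "c = - (D x' $ j / (w + D y) $ j)" using D(2) by (metis minus_divide_left nonzero_mult_div_cancel_right)
    then have "A' x' + red D x' = A' x' + D x' + c *s (w + D y)" by (simp add: red_def)
    with e D0[OF x'] have x'0: "x' = 0" by metis
    then have "c *s (w + D y) = 0" using e D(1) A'(1) by (simp add: vec.linear_0)
    then have "c = 0" using D(2) by (metis vec.scale_eq_0_iff zero_index)
    with x'0 show "x = 0" by (simp add: x'_def)
  qed
  have "A v \<noteq> 0 \<and> A v + B v \<noteq> 0 \<and> A v + C v \<noteq> 0" if v: "v \<in> V" "v \<noteq> 0" for v
  proof (intro conjI notI)
    assume "A v = 0"
    \<comment> \<open>With \<open>D = 0\<close> the reduction \<open>red D\<close> vanishes, and the
      condition is the injectivity of \<open>A'\<close> itself.\<close>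
    then have "v = 0" using A'0 w(2) by (intro key[OF v(1), of "\<lambda>_. 0"]) (simp_all add: red_def vlin_iff)
    then show False using v by simp
  next
    assume "A v + B v = 0"
    then have "v = 0" using A'0 w(3) B(1) by (intro key[OF v(1), of B]) simp_all
    then show False using v by simp
  next
    assume "A v + C v = 0"
    then have "v = 0" using A'0 w(4) C(1) by (intro key[OF v(1), of C]) simp_all
    then show False using v by simp
  qed
  with linA AU show ?thesis unfolding separable_def by blast
qed

section \<open>Induction on the dimension\<close>

lemma separable_dim_0: "separable_dim TYPE('a::field^'n) 0"
  unfolding separable_dim_def separable_def
proof (intro allI impI)
  fix V U :: "('a^'n) set" and B C
  assume "vec.subspace V \<and> vec.subspace U \<and> vec.dim V = 0 \<and> vec.dim U = 0 \<and> vlin B \<and> vlin C \<and> B ` V \<subseteq> U \<and> C ` V \<subseteq> U"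
  then show "\<exists>A. vlin A \<and> A ` V \<subseteq> U \<and> (\<forall>v\<in>V. v \<noteq> 0 \<longrightarrow> A v \<noteq> 0 \<and> A v + B v \<noteq> 0 \<and> A v + C v \<noteq> 0)"
    by (intro exI[of _ "\<lambda>x. x"]) (auto simp: vlin_iff vec.subspace_0)
qed

text \<open>Two linear equations cannot cut a space of dimension at least 3 down to 0: some nonzero
  \<open>y\<close> has \<open>B y $ j = 0\<close> and \<open>C y $ j = 0\<close>, and then
  \<open>w\<close>, \<open>w + B y\<close> and \<open>w + C y\<close> share their nonzero
  \<open>j\<close>-th coordinate.\<close>

lemma separable_dim_Suc_large_dim:
  assumes P: "separable_dim TYPE('a::field^'n) n" and n: "n \<ge> 2"
  shows "separable_dim TYPE('a^'n) (Suc n)"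
  unfolding separable_dim_def
proof (intro allI impI, elim conjE)
  fix V U :: "('a^'n) set" and B C
  assume V: "vec.subspace V" "vec.dim V = Suc n" and U: "vec.subspace U" "vec.dim U = Suc n"
    and B: "vlin B" "B ` V \<subseteq> U" and C: "vlin C" "C ` V \<subseteq> U"
  obtain w j where w: "w \<in> U" "w $ j \<noteq> 0" using dim_pos_obtains U by (metis nat.distinct(1))
  let ?V1 = "{x\<in>V. B x $ j = 0}"
  let ?V2 = "{x\<in>?V1. C x $ j = 0}"
  note fB = functional_component[OF B(1), of j] and fC = functional_component[OF C(1), of j]
  have "vec.subspace ?V1" by (rule subspace_kernel_on[OF V(1) fB])
  then have V2: "vec.subspace ?V2" by (rule subspace_kernel_on[OF _ fC])
  have "vec.dim ?V2 \<noteq> 0"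
    using dim_kernel_on_ge[OF V(1) fB] dim_kernel_on_ge[OF \<open>vec.subspace ?V1\<close> fC] V(2) n by linarith
  then obtain y k where y: "y \<in> ?V2" "y $ k \<noteq> 0" using V2 by (rule dim_pos_obtains)
  show "separable V U B C"
    by (rule separable_step[OF P V U B C _ y(2) w(1), of j]) (use y w in auto)
qed

text \<open>Here \<open>y\<close> is any nonzero vector of \<open>V\<close>, and \<open>w\<close> is
  scaled until its \<open>j\<close>-th coordinate avoids the values 0, \<open>- (B y $ j)\<close>
  and \<open>- (C y $ j)\<close>.\<close>

lemma separable_dim_Suc_large_field:
  assumes P: "separable_dim TYPE('a::field^'n) n" and q: "\<And>a b c :: 'a. \<exists>x. x \<notin> {a, b, c}"
  shows "separable_dim TYPE('a^'n) (Suc n)"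
  unfolding separable_dim_def
proof (intro allI impI, elim conjE)
  fix V U :: "('a^'n) set" and B C
  assume V: "vec.subspace V" "vec.dim V = Suc n" and U: "vec.subspace U" "vec.dim U = Suc n"
    and B: "vlin B" "B ` V \<subseteq> U" and C: "vlin C" "C ` V \<subseteq> U"
  obtain w j where w: "w \<in> U" "w $ j \<noteq> 0" using dim_pos_obtains U by (metis nat.distinct(1))
  obtain y k where y: "y \<in> V" "y $ k \<noteq> 0" using dim_pos_obtains V by (metis nat.distinct(1))
  obtain c where c: "c \<notin> {0, - (B y $ j), - (C y $ j)}" using q by metis
  let ?w = "(c / w $ j) *s w"
  show "separable V U B C"
    by (rule separable_step[OF P V U B C y, of ?w j])
      (use w c vec.subspace_scale[OF U(1) w(1)] in \<open>auto simp: eq_neg_iff_add_eq_0\<close>)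
qed

section \<open>Normal forms and the base cases\<close>

text \<open>A basis \<open>v 0, \<dots>, v (n - 1)\<close> of \<open>V\<close> with dual functionals \<open>\<kappa>\<close>, defined on the whole space.\<close>

definition frame :: "nat \<Rightarrow> (nat \<Rightarrow> 'a::field ^ 'n) \<Rightarrow> (nat \<Rightarrow> 'a ^ 'n \<Rightarrow> 'a) \<Rightarrow> ('a ^ 'n) set \<Rightarrow> bool" where
  "frame n v \<kappa> V \<longleftrightarrow> (\<forall>i<n. v i \<in> V \<and> functional (\<kappa> i)) \<and>
     (\<forall>i<n. \<forall>j<n. \<kappa> i (v j) = of_bool (i = j)) \<and> (\<forall>x\<in>V. x = (\<Sum>i<n. \<kappa> i x *s v i))"

text \<open>The old functionals are composed with the projection along \<open>y\<close>, which makes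
  them vanish on \<open>y\<close>; the new vector and its functional take index 0.\<close>

lemma frame_Suc:
  fixes V :: "('a::field ^ 'n) set"
  assumes V: "vec.subspace V" and \<eta>: "functional \<eta>" and y: "y \<in> V" "\<eta> y = 1"
    and fr: "frame n v \<kappa> {x\<in>V. \<eta> x = 0}"
  shows "frame (Suc n) (case_nat y v) (case_nat \<eta> (\<lambda>i x. \<kappa> i (x - \<eta> x *s y))) V"
proof -
  have \<kappa>: "functional (\<kappa> i)" if "i < n" for i using fr that by (simp add: frame_def)
  have v: "v i \<in> V" "\<eta> (v i) = 0" if "i < n" for i using fr that by (simp_all add: frame_def)
  have dual: "\<kappa> i (v j) = of_bool (i = j)" if "i < n" "j < n" for i j using fr that by (simp add: frame_def)
  have "functional (\<lambda>x. \<kappa> i (x - \<eta> x *s y))" if "i < n" for i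
    using \<kappa>[OF that] \<eta>
    by (simp add: functional_def functional_diff[OF \<kappa>[OF that]] algebra_simps)
  moreover have "x = \<eta> x *s y + (\<Sum>i<n. \<kappa> i (x - \<eta> x *s y) *s v i)" if "x \<in> V" for x
  proof -
    have "x - \<eta> x *s y \<in> {x\<in>V. \<eta> x = 0}"
      using that y V by (auto simp: functional_diff[OF \<eta>] functional_scale[OF \<eta>] intro!: vec.subspace_diff vec.subspace_scale)
    then have "x - \<eta> x *s y = (\<Sum>i<n. \<kappa> i (x - \<eta> x *s y) *s v i)" using fr unfolding frame_def by blast
    then show ?thesis by (metis add.commute diff_add_cancel)
  qed
  ultimately show ?thesis
    using \<eta> y v dual \<kappa>
    by (auto simp: frame_def less_Suc_eq_0_disj functional_0 sum.lessThan_Suc_shift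
        simp del: sum.lessThan_Suc)
qed

lemma frame_0: "vec.dim V = 0 \<Longrightarrow> frame 0 v \<kappa> V"
  by (auto simp: frame_def)

lemma frame_exists:
  fixes V :: "('a::field ^ 'n) set"
  assumes "vec.subspace V" "vec.dim V = n"
  shows "\<exists>v \<kappa>. frame n v \<kappa> V"
  using assms
proof (induction n arbitrary: V)
  case 0
  then show ?case using frame_0 by blast
next
  case (Suc n)
  then obtain y j where y: "y \<in> V" "y $ j \<noteq> 0" using dim_pos_obtains[of V] by auto
  define \<eta> where "\<eta> = (\<lambda>x::'a^'n. x $ j / y $ j)"
  have \<eta>: "functional \<eta>" "\<eta> y = 1" using y by (simp_all add: \<eta>_def functional_def add_divide_distrib)
  have "vec.dim {x\<in>V. \<eta> x = 0} = n"
    using dim_kernel_on[OF Suc.prems(1) \<eta>(1) y(1)] \<eta>(2) Suc.prems(2) by simp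
  then obtain v \<kappa> where "frame n v \<kappa> {x\<in>V. \<eta> x = 0}"
    using Suc.IH[OF subspace_kernel_on[OF Suc.prems(1) \<eta>(1)]] by blast
  from frame_Suc[OF Suc.prems(1) \<eta>(1) y(1) \<eta>(2) this] show ?case by blast
qed

text \<open>Rank normal form of \<open>B\<close>. If \<open>B\<close> is nonzero on
  \<open>V\<close>, some \<open>y\<close> in \<open>V\<close> has \<open>B y $ j = 1\<close>. Then
  \<open>B\<close> maps the kernel of \<open>x \<mapsto> B x $ j\<close> in \<open>V\<close> into
  the kernel of the \<open>j\<close>-th coordinate in \<open>U\<close>, and \<open>y\<close> and
  \<open>B y\<close> become the first basis vectors.\<close>

lemma frame_normal_form:
  fixes V U :: "('a::field ^ 'n) set"
  assumes "vec.subspace V" "vec.dim V = n" "vec.subspace U" "vec.dim U = n" "vlin B" "B ` V \<subseteq> U"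
  shows "\<exists>r\<le>n. \<exists>v \<kappa> u \<mu>. frame n v \<kappa> V \<and> frame n u \<mu> U \<and> (\<forall>i<n. B (v i) = (if i < r then u i else 0))"
  using assms(1-4,6)
proof (induction n arbitrary: V U)
  case 0
  then show ?case using frame_0[of V] frame_0[of U] by (intro exI[of _ 0]) simp
next
  case (Suc n)
  note V = Suc.prems(1,2) and U = Suc.prems(3,4) and BVU = Suc.prems(5)
  show ?case
  proof (cases "\<forall>x\<in>V. B x = 0")
    case True
    obtain v \<kappa> u \<mu> where "frame (Suc n) v \<kappa> V" "frame (Suc n) u \<mu> U"
      using frame_exists V U by metis
    moreover from this True have "\<forall>i<Suc n. B (v i) = (if i < 0 then u i else 0)" by (simp add: frame_def)
    ultimately show ?thesis by blast
  next
    case False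
    then obtain y0 j where y0: "y0 \<in> V" "B y0 $ j \<noteq> 0" by (auto simp: vec_eq_iff)
    define y where "y = (1 / B y0 $ j) *s y0"
    have y: "y \<in> V" "B y $ j = 1"
      using y0 V by (simp_all add: y_def vec.subspace_scale vec.linear_scale[OF assms(5)])
    have f: "functional (\<lambda>x. B x $ j)" "functional (\<lambda>x::'a^'n. x $ j)"
      using functional_component[OF assms(5)] by (auto simp: functional_def)
    let ?V = "{x\<in>V. B x $ j = 0}" and ?U = "{x\<in>U. x $ j = 0}"
    have By: "B y \<in> U" using y BVU by auto
    have d: "vec.dim ?V = n" "vec.dim ?U = n"
      using dim_kernel_on[OF V(1) f(1) y(1)] dim_kernel_on[OF U(1) f(2) By] y V U by simp_all
    have "B ` ?V \<subseteq> ?U" using BVU by auto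
    then obtain r v \<kappa> u \<mu> where r: "r \<le> n" and fr: "frame n v \<kappa> ?V" "frame n u \<mu> ?U"
      and Bv: "\<forall>i<n. B (v i) = (if i < r then u i else 0)"
      using Suc.IH[OF subspace_kernel_on[OF V(1) f(1)] d(1) subspace_kernel_on[OF U(1) f(2)] d(2)] by blast
    note F = frame_Suc[OF V(1) f(1) y fr(1)] frame_Suc[OF U(1) f(2) By y(2) fr(2)]
    have "\<forall>i<Suc n. B (case_nat y v i) = (if i < Suc r then case_nat (B y) u i else 0)"
      using Bv by (auto simp: less_Suc_eq_0_disj)
    with F r show ?thesis by (intro exI[of _ "Suc r"] conjI exI) simp_all
  qed
qed

section \<open>Matrix criteria for injectivity and exhaustive searches over F_2 and F_3\<close>

definition nonsingular :: "nat \<Rightarrow> (nat \<Rightarrow> nat \<Rightarrow> 'a::field) \<Rightarrow> bool" where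
  "nonsingular n m \<longleftrightarrow> (\<forall>c. (\<forall>i<n. (\<Sum>j<n. m i j * c j) = 0) \<longrightarrow> (\<forall>j<n. c j = 0))"

text \<open>\<open>a\<close> is the matrix of \<open>A\<close> in the two frames;
  \<open>\<mu> i (B (v j))\<close> and \<open>\<mu> i (C (v j))\<close> are the matrix entries of
  \<open>B\<close> and \<open>C\<close>.\<close>

lemma separable_if_nonsingular:
  fixes V U :: "('a::field ^ 'n) set"
  assumes V: "frame n v \<kappa> V" and U: "frame n u \<mu> U" "vec.subspace U" and B: "vlin B" and C: "vlin C"
    and a: "nonsingular n a" "nonsingular n (\<lambda>i j. a i j + \<mu> i (B (v j)))" "nonsingular n (\<lambda>i j. a i j + \<mu> i (C (v j)))"
  shows "separable V U B C"
proof -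
  have \<kappa>: "functional (\<kappa> i)" and \<mu>: "functional (\<mu> i)" and uU: "u i \<in> U" if "i < n" for i
    using V U that by (simp_all add: frame_def)
  \<comment> \<open>\<open>\<rho> i x\<close> is meant as the \<open>i\<close>-th coordinate of
    \<open>A x\<close>.\<close>
  define \<rho> where "\<rho> i x = (\<Sum>j<n. a i j * \<kappa> j x)" for i x
  have \<rho>: "\<rho> i (x + y) = \<rho> i x + \<rho> i y" "\<rho> i (c *s x) = c * \<rho> i x" for i x y c
    unfolding \<rho>_def sum.distrib[symmetric] sum_distrib_left
    by (auto intro!: sum.cong simp: functional_add[OF \<kappa>] functional_scale[OF \<kappa>] algebra_simps)
  define A where "A x = (\<Sum>i<n. \<rho> i x *s u i)" for x
  have linA: "vlin A"
    unfolding A_def by (intro vlinI) (simp_all add: \<rho> vec.scale_left_distrib sum.distrib vec.scale_sum_right)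
  have AU: "A ` V \<subseteq> U"
    unfolding A_def using uU by (auto intro!: vec.subspace_sum[OF U(2)] vec.subspace_scale[OF U(2)])
  have zero: "x = 0" if x: "x \<in> V" and z: "A x + D x = 0" and D: "vlin D"
    and ns: "nonsingular n (\<lambda>i j. a i j + \<mu> i (D (v j)))" for x D
  proof -
    have xs: "x = (\<Sum>j<n. \<kappa> j x *s v j)" using V x by (simp add: frame_def)
    have "(\<Sum>j<n. (a i j + \<mu> i (D (v j))) * \<kappa> j x) = 0" if i: "i < n" for i
    proof -
      have "\<mu> i (A x) = (\<Sum>k<n. \<rho> k x * \<mu> i (u k))"
        by (simp add: A_def functional_sum[OF \<mu>[OF i]] functional_scale[OF \<mu>[OF i]])
      also have "\<dots> = (\<Sum>k<n. if k = i then \<rho> k x else 0)"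
        using U(1) i by (intro sum.cong) (auto simp: frame_def)
      also have "\<dots> = (\<Sum>j<n. a i j * \<kappa> j x)" using i by (simp add: \<rho>_def)
      finally have 1: "\<mu> i (A x) = (\<Sum>j<n. a i j * \<kappa> j x)" .
      have "D x = (\<Sum>j<n. \<kappa> j x *s D (v j))"
        by (subst xs) (simp add: vec.linear_sum[OF D] vec.linear_scale[OF D])
      then have 2: "\<mu> i (D x) = (\<Sum>j<n. \<kappa> j x * \<mu> i (D (v j)))"
        by (simp add: functional_sum[OF \<mu>[OF i]] functional_scale[OF \<mu>[OF i]])
      have "\<mu> i (A x + D x) = 0" using z functional_0[OF \<mu>[OF i]] by simp
      then show ?thesis using 1 2 by (simp add: functional_add[OF \<mu>[OF i]] sum.distrib algebra_simps)
    qed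
    then have "\<forall>j<n. \<kappa> j x = 0" using ns[unfolded nonsingular_def, rule_format, of "\<lambda>j. \<kappa> j x"] by blast
    with xs show "x = 0" by simp
  qed
  have ns0: "nonsingular n (\<lambda>i j. a i j + \<mu> i ((\<lambda>_. 0) (v j)))"
    using a(1) functional_0[OF \<mu>] by (simp add: nonsingular_def)
  have "A x \<noteq> 0 \<and> A x + B x \<noteq> 0 \<and> A x + C x \<noteq> 0" if "x \<in> V" "x \<noteq> 0" for x
    using zero[OF that(1) _ _ ns0] zero[OF that(1) _ B a(2)] zero[OF that(1) _ C a(3)] that(2)
    by (auto simp: vlin_iff)
  with linA AU show ?thesis unfolding separable_def by blast
qed

text \<open>Cramer's rule: applying the adjugate to the system isolates the determinant times each
  unknown.\<close>

lemma nonsingular2: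
  assumes "m 0 0 * m 1 1 - m 0 1 * m 1 0 \<noteq> 0"
  shows "nonsingular 2 m"
  unfolding nonsingular_def
proof (intro allI impI)
  fix c j assume h: "\<forall>i<2. (\<Sum>j<2. m i j * c j) = 0" and j: "j < (2::nat)"
  have "m 0 0 * c 0 + m 0 1 * c 1 = 0" "m 1 0 * c 0 + m 1 1 * c 1 = 0"
    using h[rule_format, of 0] h[rule_format, of 1] by (simp_all add: numeral_2_eq_2)
  moreover have "(m 0 0 * m 1 1 - m 0 1 * m 1 0) * c 0 =
      m 1 1 * (m 0 0 * c 0 + m 0 1 * c 1) - m 0 1 * (m 1 0 * c 0 + m 1 1 * c 1)"
    "(m 0 0 * m 1 1 - m 0 1 * m 1 0) * c 1 =
      m 0 0 * (m 1 0 * c 0 + m 1 1 * c 1) - m 1 0 * (m 0 0 * c 0 + m 0 1 * c 1)"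
    by (simp_all add: algebra_simps)
  ultimately have "(m 0 0 * m 1 1 - m 0 1 * m 1 0) * c 0 = 0" "(m 0 0 * m 1 1 - m 0 1 * m 1 0) * c 1 = 0"
    by simp_all
  with assms have "c 0 = 0" "c 1 = 0" by simp_all
  moreover have "j = 0 \<or> j = 1" using j by auto
  ultimately show "c j = 0" by auto
qed

lemma nonsingular3:
  assumes "m 0 0 * (m 1 1 * m 2 2 - m 1 2 * m 2 1) - m 0 1 * (m 1 0 * m 2 2 - m 1 2 * m 2 0)
    + m 0 2 * (m 1 0 * m 2 1 - m 1 1 * m 2 0) \<noteq> 0" (is "?d \<noteq> 0")
  shows "nonsingular 3 m"
  unfolding nonsingular_def
proof (intro allI impI)
  fix c j assume h: "\<forall>i<3. (\<Sum>j<3. m i j * c j) = 0" and j: "j < (3::nat)"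
  have "m 0 0 * c 0 + m 0 1 * c 1 + m 0 2 * c 2 = 0" "m 1 0 * c 0 + m 1 1 * c 1 + m 1 2 * c 2 = 0"
    "m 2 0 * c 0 + m 2 1 * c 1 + m 2 2 * c 2 = 0"
    using h[rule_format, of 0] h[rule_format, of 1] h[rule_format, of 2] by (simp_all add: numeral_3_eq_3 numeral_2_eq_2)
  \<comment> \<open>The coefficients on the right are the rows of the adjugate.\<close>
  moreover have "?d * c 0 = (m 1 1 * m 2 2 - m 1 2 * m 2 1) * (m 0 0 * c 0 + m 0 1 * c 1 + m 0 2 * c 2)
      - (m 0 1 * m 2 2 - m 0 2 * m 2 1) * (m 1 0 * c 0 + m 1 1 * c 1 + m 1 2 * c 2)
      + (m 0 1 * m 1 2 - m 0 2 * m 1 1) * (m 2 0 * c 0 + m 2 1 * c 1 + m 2 2 * c 2)"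
    "?d * c 1 = - (m 1 0 * m 2 2 - m 1 2 * m 2 0) * (m 0 0 * c 0 + m 0 1 * c 1 + m 0 2 * c 2)
      + (m 0 0 * m 2 2 - m 0 2 * m 2 0) * (m 1 0 * c 0 + m 1 1 * c 1 + m 1 2 * c 2)
      - (m 0 0 * m 1 2 - m 0 2 * m 1 0) * (m 2 0 * c 0 + m 2 1 * c 1 + m 2 2 * c 2)"
    "?d * c 2 = (m 1 0 * m 2 1 - m 1 1 * m 2 0) * (m 0 0 * c 0 + m 0 1 * c 1 + m 0 2 * c 2)
      - (m 0 0 * m 2 1 - m 0 1 * m 2 0) * (m 1 0 * c 0 + m 1 1 * c 1 + m 1 2 * c 2)
      + (m 0 0 * m 1 1 - m 0 1 * m 1 0) * (m 2 0 * c 0 + m 2 1 * c 1 + m 2 2 * c 2)"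
    by (simp_all add: algebra_simps)
  ultimately have "?d * c 0 = 0" "?d * c 1 = 0" "?d * c 2 = 0" by simp_all
  with assms have "c 0 = 0" "c 1 = 0" "c 2 = 0" by simp_all
  moreover have "j = 0 \<or> j = 1 \<or> j = 2" using j by auto
  ultimately show "c j = 0" by auto
qed

text \<open>The determinant over F_2, with conjunction as product and inequality of truth values as
  sum.\<close>

definition bdet3 :: "bool \<Rightarrow> bool \<Rightarrow> bool \<Rightarrow> bool \<Rightarrow> bool \<Rightarrow> bool \<Rightarrow> bool \<Rightarrow> bool \<Rightarrow> bool \<Rightarrow> bool" where
  "bdet3 a b c d e f g h i \<longleftrightarrow>
     ((a \<and> ((e \<and> i) \<noteq> (f \<and> h))) \<noteq> (b \<and> ((d \<and> i) \<noteq> (f \<and> g)))) \<noteq> (c \<and> ((d \<and> h) \<noteq> (e \<and> g)))"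

text \<open>Here \<open>B = diag(1, e\<^sub>2, e\<^sub>3)\<close>; the case \<open>B = 0\<close> needs only two of the three conditions, so it is
  covered as well.\<close>

lemma bdet3_separation:
 "\<forall>e2 e3. (e3 \<longrightarrow> e2) \<longrightarrow> (\<forall>b1 b2 b3 b4 b5 b6 b7 b8 b9. \<exists>a1 a2 a3 a4 a5 a6 a7 a8 a9.
    bdet3 a1 a2 a3 a4 a5 a6 a7 a8 a9 \<and> bdet3 (\<not> a1) a2 a3 a4 (a5 \<noteq> e2) a6 a7 a8 (a9 \<noteq> e3) \<and>
    bdet3 (a1 \<noteq> b1) (a2 \<noteq> b2) (a3 \<noteq> b3) (a4 \<noteq> b4) (a5 \<noteq> b5) (a6 \<noteq> b6) (a7 \<noteq> b7) (a8 \<noteq> b8) (a9 \<noteq> b9))"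
  by code_simp

text \<open>The analogous search over F_3 with \<open>B = diag(1, e)\<close>; entries are integer
  representatives, and \<open>b1\<close> to \<open>b4\<close> are those of \<open>C\<close>.\<close>

lemma idet2_separation:
 "\<forall>e\<in>set [0, 1::int]. \<forall>b1\<in>set [0, 1, 2]. \<forall>b2\<in>set [0, 1, 2]. \<forall>b3\<in>set [0, 1, 2]. \<forall>b4\<in>set [0, 1, 2].
    \<exists>a1\<in>set [0, 1, 2]. \<exists>a2\<in>set [0, 1, 2]. \<exists>a3\<in>set [0, 1, 2]. \<exists>a4\<in>set [0, 1, 2].
      (a1 * a4 - a2 * a3) mod 3 \<noteq> 0 \<and> ((a1 + 1) * (a4 + e) - a2 * a3) mod 3 \<noteq> 0 \<and>
      ((a1 + b1) * (a4 + b4) - (a2 + b2) * (a3 + b3)) mod 3 \<noteq> 0"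
  by code_simp

lemma mod_ring_of_int:
  fixes x :: "'p::prime_card mod_ring"
  obtains k where "0 \<le> k" "k < int CARD('p)" "x = of_int k"
proof -
  obtain i where "i < CARD('p)" "x = of_nat i" using surj_of_nat_mod_ring by blast
  then show thesis using that[of "int i"] by simp
qed

lemma mod_ring_of_int_eq_0_iff: "(of_int k :: 'p::prime_card mod_ring) = 0 \<longleftrightarrow> k mod int CARD('p) = 0"
  by (simp add: of_int_eq_0_iff_char_dvd dvd_eq_mod_eq_0)

lemma separable_dim_2_card_3:
  assumes p: "CARD('p::prime_card) = 3"
  shows "separable_dim TYPE('p mod_ring ^ 'n) 2"
  unfolding separable_dim_def
proof (intro allI impI, elim conjE)
  fix V U :: "('p mod_ring ^ 'n) set" and B C
  assume V: "vec.subspace V" "vec.dim V = 2" and U: "vec.subspace U" "vec.dim U = 2"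
    and B: "vlin B" "B ` V \<subseteq> U" and C: "vlin C" "C ` V \<subseteq> U"
  obtain r v \<kappa> u \<mu> where fr: "frame 2 v \<kappa> V" "frame 2 u \<mu> U"
    and Bv: "\<forall>i<2. B (v i) = (if i < r then u i else 0)"
    using frame_normal_form[OF V U B] by blast
  have \<mu>: "functional (\<mu> i)" "\<mu> i (u j) = of_bool (i = j)" if "i < 2" "j < 2" for i j
    using fr(2) that by (auto simp: frame_def)
  have B\<mu>: "\<mu> i (B (v j)) = of_bool (i = j \<and> j < r)" if "i < 2" "j < 2" for i j
    using Bv \<mu>[OF that] that by (simp add: functional_0)
  have "\<exists>k. k \<in> set [0, 1, 2] \<and> x = of_int k" for x :: "'p mod_ring"
  proof -
    obtain k where "0 \<le> k" "k < 3" "x = of_int k" using p by (metis mod_ring_of_int of_nat_numeral)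
    moreover from this have "k = 0 \<or> k = 1 \<or> k = 2" by linarith
    ultimately show ?thesis by auto
  qed
  then obtain h where h: "\<And>x :: 'p mod_ring. h x \<in> set [0, 1, 2] \<and> x = of_int (h x)" by metis
  let ?b = "\<lambda>i j. h (\<mu> i (C (v j)))"
  \<comment> \<open>The second diagonal entry of \<open>B\<close>; the first is 1 unless
    \<open>r = 0\<close>.\<close>
  define e :: int where "e = of_bool (1 < r)"
  have "e \<in> set [0, 1]" by (simp add: e_def)
  then obtain a1 a2 a3 a4 where a: "(a1 * a4 - a2 * a3) mod 3 \<noteq> 0" "((a1 + 1) * (a4 + e) - a2 * a3) mod 3 \<noteq> 0"
      "((a1 + ?b 0 0) * (a4 + ?b 1 1) - (a2 + ?b 0 1) * (a3 + ?b 1 0)) mod 3 \<noteq> 0"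
    using idet2_separation h by meson
  define a :: "nat \<Rightarrow> nat \<Rightarrow> 'p mod_ring" where "a i j = of_int ([a1, a2, a3, a4] ! (2 * i + j))" for i j
  have nz: "(of_int k :: 'p mod_ring) \<noteq> 0" if "k mod 3 \<noteq> 0" for k
    using that p by (simp add: mod_ring_of_int_eq_0_iff)
  have n1: "nonsingular 2 a"
    using nz[OF a(1)] by (intro nonsingular2) (simp add: a_def)
  have n2: "nonsingular 2 (\<lambda>i j. a i j + \<mu> i (B (v j)))"
  \<comment> \<open>For \<open>r = 0\<close> the matrix of \<open>B\<close> is 0 and the condition
    repeats the one on \<open>a\<close>.\<close>
  proof (cases "r = 0")
    case True
    then show ?thesis using n1 B\<mu> by (simp add: nonsingular_def)
  next
    case False
    then show ?thesis using nz[OF a(2)] by (intro nonsingular2) (simp add: a_def B\<mu> e_def)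
  qed
  have n3: "nonsingular 2 (\<lambda>i j. a i j + \<mu> i (C (v j)))"
    using nz[OF a(3)] h by (intro nonsingular2) (simp add: a_def)
  show "separable V U B C" by (rule separable_if_nonsingular[OF fr U(1) B(1) C(1) n1 n2 n3])
qed

lemma separable_dim_3_card_2:
  assumes p: "CARD('p::prime_card) = 2"
  shows "separable_dim TYPE('p mod_ring ^ 'n) 3"
  unfolding separable_dim_def
proof (intro allI impI, elim conjE)
  fix V U :: "('p mod_ring ^ 'n) set" and B C
  assume V: "vec.subspace V" "vec.dim V = 3" and U: "vec.subspace U" "vec.dim U = 3"
    and B: "vlin B" "B ` V \<subseteq> U" and C: "vlin C" "C ` V \<subseteq> U"
  obtain r v \<kappa> u \<mu> where fr: "frame 3 v \<kappa> V" "frame 3 u \<mu> U"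
    and Bv: "\<forall>i<3. B (v i) = (if i < r then u i else 0)"
    using frame_normal_form[OF V U B] by blast
  have \<mu>: "functional (\<mu> i)" "\<mu> i (u j) = of_bool (i = j)" if "i < 3" "j < 3" for i j
    using fr(2) that by (auto simp: frame_def)
  have B\<mu>: "\<mu> i (B (v j)) = of_bool (i = j \<and> j < r)" if "i < 3" "j < 3" for i j
    using Bv \<mu>[OF that] that by (simp add: functional_0)
  have "x = 0 \<or> x = 1" for x :: "'p mod_ring"
  proof -
    obtain k where "0 \<le> k" "k < 2" "x = of_int k" using p by (metis mod_ring_of_int of_nat_numeral)
    moreover from this have "k = 0 \<or> k = 1" by linarith
    ultimately show ?thesis by auto
  qed
  then have h: "x = of_bool (x = 1)" for x :: "'p mod_ring" by auto
  have "(2 :: 'p mod_ring) = 0" using of_nat_card_eq_0[where 'a='p] p by simp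
  then have "(1 + 1 :: 'p mod_ring) = 0" by simp
  then have neg: "(- 1 :: 'p mod_ring) = 1" by (simp add: eq_neg_iff_add_eq_0 minus_equation_iff)
  \<comment> \<open>Both forms hold in characteristic 2; the expansion of the determinant contains
    differences as well as sums.\<close>
  have xor: "(of_bool (s \<noteq> t) :: 'p mod_ring) = of_bool s - of_bool t"
    "(of_bool (s \<noteq> t) :: 'p mod_ring) = of_bool s + of_bool t" for s t
    using neg \<open>(1 + 1 :: 'p mod_ring) = 0\<close> by (cases s; cases t; simp)+
  have det: "of_bool s1 * (of_bool s5 * of_bool s9 - of_bool s6 * of_bool s8)
      - of_bool s2 * (of_bool s4 * of_bool s9 - of_bool s6 * of_bool s7)
      + of_bool s3 * (of_bool s4 * of_bool s8 - of_bool s5 * of_bool s7)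
      = (of_bool (bdet3 s1 s2 s3 s4 s5 s6 s7 s8 s9) :: 'p mod_ring)" for s1 s2 s3 s4 s5 s6 s7 s8 s9
    unfolding bdet3_def by (subst xor(2)) (simp only: xor(1) of_bool_conj)
  let ?b = "\<lambda>i j. \<mu> i (C (v j)) = 1"
  \<comment> \<open>In the normal form a nonzero third diagonal entry forces a nonzero second
    one.\<close>
  have "2 < r \<longrightarrow> 1 < r" by simp
  from bdet3_separation[THEN spec, THEN spec, THEN mp, OF this, rule_format, of "?b 0 0" "?b 0 1" "?b 0 2" "?b 1 0" "?b 1 1" "?b 1 2" "?b 2 0" "?b 2 1" "?b 2 2"]
  obtain a1 a2 a3 a4 a5 a6 a7 a8 a9 where a: "bdet3 a1 a2 a3 a4 a5 a6 a7 a8 a9"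
      "bdet3 (\<not> a1) a2 a3 a4 (a5 \<noteq> (1 < r)) a6 a7 a8 (a9 \<noteq> (2 < r))"
      "bdet3 (a1 \<noteq> ?b 0 0) (a2 \<noteq> ?b 0 1) (a3 \<noteq> ?b 0 2) (a4 \<noteq> ?b 1 0) (a5 \<noteq> ?b 1 1) (a6 \<noteq> ?b 1 2)
        (a7 \<noteq> ?b 2 0) (a8 \<noteq> ?b 2 1) (a9 \<noteq> ?b 2 2)"
    by (elim exE conjE)
  define \<alpha> where "\<alpha> i j = [a1, a2, a3, a4, a5, a6, a7, a8, a9] ! (3 * i + j)" for i j
  define a :: "nat \<Rightarrow> nat \<Rightarrow> 'p mod_ring" where "a i j = of_bool (\<alpha> i j)" for i j
  have ns: "nonsingular 3 m" if "\<And>i j. i < 3 \<Longrightarrow> j < 3 \<Longrightarrow> m i j = of_bool (s i j)"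
    "bdet3 (s 0 0) (s 0 1) (s 0 2) (s 1 0) (s 1 1) (s 1 2) (s 2 0) (s 2 1) (s 2 2)"
    for m :: "nat \<Rightarrow> nat \<Rightarrow> 'p mod_ring" and s
    by (rule nonsingular3) (simp only: that(1) det, use that(2) in simp)
  have n1: "nonsingular 3 a"
    by (rule ns[of _ \<alpha>]) (use a(1) in \<open>simp_all add: a_def \<alpha>_def eval_nat_numeral\<close>)
  have n2: "nonsingular 3 (\<lambda>i j. a i j + \<mu> i (B (v j)))"
  proof (cases "r = 0")
    case True
    then show ?thesis using n1 B\<mu> by (simp add: nonsingular_def)
  next
    case False
    then show ?thesis
      by (intro ns[of _ "\<lambda>i j. \<alpha> i j \<noteq> (i = j \<and> j < r)"])
        (use a(2) in \<open>simp_all only: a_def xor(2) B\<mu>, simp_all add: \<alpha>_def eval_nat_numeral\<close>)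
  qed
  have n3: "nonsingular 3 (\<lambda>i j. a i j + \<mu> i (C (v j)))"
  proof (rule ns[of _ "\<lambda>i j. \<alpha> i j \<noteq> ?b i j"])
    show "a i j + \<mu> i (C (v j)) = of_bool (\<alpha> i j \<noteq> ?b i j)" for i j
      unfolding xor(2) a_def using h[of "\<mu> i (C (v j))"] by simp
  qed (use a(3) in \<open>simp add: \<alpha>_def eval_nat_numeral\<close>)
  show "separable V U B C" by (rule separable_if_nonsingular[OF fr U(1) B(1) C(1) n1 n2 n3])
qed

text \<open>The induction starts at dimension 3 for \<open>p = 2\<close>, at 2 for
  \<open>p = 3\<close> and at 0 for larger \<open>p\<close>; the excluded pairs are the positive
  dimensions below these starting points.\<close>

lemma separable_dim_mod_ring:
  assumes "\<not> (n = 1 \<and> CARD('p::prime_card) = 2)" "\<not> (n = 1 \<and> CARD('p) = 3)" "\<not> (n = 2 \<and> CARD('p) = 2)" "n \<noteq> 0"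
  shows "separable_dim TYPE('p mod_ring ^ 'n) n"
proof -
  consider "CARD('p) = 2" | "CARD('p) = 3" | "CARD('p) \<ge> 4"
    using prime_ge_2_nat[OF prime_card[where 'a='p]] by linarith
  then show ?thesis
  proof cases
    case 1
    with assms have "3 \<le> n" by linarith
    then show ?thesis
      by (induction rule: dec_induct) (simp_all add: separable_dim_3_card_2[OF 1] separable_dim_Suc_large_dim)
  next
    case 2
    with assms have "2 \<le> n" by linarith
    then show ?thesis
      by (induction rule: dec_induct) (simp_all add: separable_dim_2_card_3[OF 2] separable_dim_Suc_large_dim)
  next
    case 3
    have "\<exists>x. x \<notin> {a, b, c}" for a b c :: "'p mod_ring"
    proof (rule ccontr)
      assume "\<nexists>x. x \<notin> {a, b, c}"
      then have "UNIV = {a, b, c}" by auto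
      moreover have "card {a, b, c} \<le> 3" by (simp add: card_insert_if)
      ultimately have "CARD('p mod_ring) \<le> 3" by simp
      then show False using 3 by simp
    qed
    then show ?thesis
      by (induction n) (simp_all add: separable_dim_0 separable_dim_Suc_large_field)
  qed
qed

section \<open>Cycle types of skew products\<close>

lemma self_in_orbit_of: "x \<in> orbit_of f x"
  unfolding orbit_of_def by (rule CollectI, rule exI[of _ 0]) simp

lemma orbit_of_funpow_subset: "y \<in> orbit_of f x \<Longrightarrow> orbit_of f y \<subseteq> orbit_of f x"
  unfolding orbit_of_def by clarsimp (metis comp_apply funpow_add)

lemma funpow_return:
  fixes f :: "'a::finite \<Rightarrow> 'a"
  assumes "inj f"
  shows "\<exists>n>0. (f ^^ n) x = x"
  by (rule funpow_inj_finite[OF assms, of x]) auto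

lemma orbit_of_eq:
  fixes f :: "'a::finite \<Rightarrow> 'a"
  assumes f: "inj f" and y: "y \<in> orbit_of f x"
  shows "orbit_of f y = orbit_of f x"
proof
  show "orbit_of f y \<subseteq> orbit_of f x" by (rule orbit_of_funpow_subset[OF y])
  obtain k where k: "y = (f ^^ k) x" using y by (auto simp: orbit_of_def)
  obtain n where n: "n > 0" "(f ^^ n) x = x" using funpow_return[OF f] by blast
  \<comment> \<open>\<open>n * k\<close> is a multiple of the return time \<open>n\<close> and at
    least \<open>k\<close>, so \<open>n * k - k\<close> further steps lead from \<open>y\<close>
    back to \<open>x\<close>.\<close>
  have "(f ^^ (n * k)) x = x"
    by (induction k) (use n(2) in \<open>simp_all add: funpow_add\<close>)
  moreover have "n * k = (n * k - k) + k" using n(1) by simp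
  ultimately have "(f ^^ (n * k - k)) y = x" unfolding k by (metis comp_apply funpow_add)
  then have "x \<in> orbit_of f y" by (auto simp: orbit_of_def)
  then show "orbit_of f x \<subseteq> orbit_of f y" by (rule orbit_of_funpow_subset)
qed

text \<open>The cycle length is the least return time \<open>m\<close>: earlier iterates are
  distinct, and exponents may be reduced modulo \<open>m\<close>.\<close>

lemma orbit_of_enum:
  fixes f :: "'a::finite \<Rightarrow> 'a" and x :: 'a
  assumes f: "inj f"
  defines "l \<equiv> card (orbit_of f x)"
  shows "l > 0" "(f ^^ l) x = x" "inj_on (\<lambda>k. (f ^^ k) x) {..<l}" "orbit_of f x = (\<lambda>k. (f ^^ k) x) ` {..<l}"
proof -
  define m where "m = (LEAST n. n > 0 \<and> (f ^^ n) x = x)"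
  have m: "m > 0" "(f ^^ m) x = x"
    using LeastI_ex[OF funpow_return[OF f, of x]] by (simp_all add: m_def)
  have least: "m \<le> n" if "n > 0" "(f ^^ n) x = x" for n
    unfolding m_def using that by (intro Least_le) simp
  have inj: "inj_on (\<lambda>k. (f ^^ k) x) {..<m}"
  proof (rule linorder_inj_onI)
    fix i j assume ij: "i < j" "i \<in> {..<m}" "j \<in> {..<m}"
    show "(f ^^ i) x \<noteq> (f ^^ j) x"
    proof
      assume "(f ^^ i) x = (f ^^ j) x"
      also have "(f ^^ j) x = (f ^^ i) ((f ^^ (j - i)) x)"
        using ij(1) by (metis comp_apply funpow_add le_add_diff_inverse less_imp_le)
      finally have "(f ^^ (j - i)) x = x" using inj_fn[OF f] by (metis injD)
      then show False using least[of "j - i"] ij by auto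
    qed
  qed auto
  have orb: "orbit_of f x = (\<lambda>k. (f ^^ k) x) ` {..<m}"
  proof -
    have "(f ^^ n) x = (f ^^ (n mod m)) x" for n using funpow_mod_eq[OF m(2)] by metis
    then show ?thesis using m(1) by (force simp: orbit_of_def)
  qed
  have "l = m" unfolding l_def orb by (simp add: card_image[OF inj])
  then show "l > 0" "(f ^^ l) x = x" "inj_on (\<lambda>k. (f ^^ k) x) {..<l}" "orbit_of f x = (\<lambda>k. (f ^^ k) x) ` {..<l}"
    using m inj orb by simp_all
qed

section \<open>Cycle types of unions, conjugates and return maps\<close>

lemma cycle_type_altdef: "cycle_type f \<Omega> = image_mset card (mset_set (orbit_of f ` \<Omega>))"
  unfolding cycle_type_def by (rule arg_cong[where f = "\<lambda>X. image_mset card (mset_set X)"]) blast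

lemma orbit_of_subset:
  assumes "f ` \<Omega> \<subseteq> \<Omega>" "x \<in> \<Omega>"
  shows "orbit_of f x \<subseteq> \<Omega>"
proof -
  have "(f ^^ n) x \<in> \<Omega>" for n by (induction n) (use assms in auto)
  then show ?thesis by (auto simp: orbit_of_def)
qed

text \<open>An orbit stays in the invariant set it starts in, so no orbit is shared by two of the
  pieces and the multisets add up.\<close>

lemma cycle_type_UN:
  fixes f :: "'a::finite \<Rightarrow> 'a"
  assumes "finite I" "\<And>i. i \<in> I \<Longrightarrow> f ` \<Omega> i \<subseteq> \<Omega> i" "\<And>i j. i \<in> I \<Longrightarrow> j \<in> I \<Longrightarrow> i \<noteq> j \<Longrightarrow> \<Omega> i \<inter> \<Omega> j = {}"
  shows "cycle_type f (\<Union>i\<in>I. \<Omega> i) = (\<Sum>i\<in>I. cycle_type f (\<Omega> i))"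
  using assms
proof (induction I rule: finite_induct)
  case empty
  then show ?case by (simp add: cycle_type_altdef)
next
  case (insert i I)
  have "orbit_of f ` \<Omega> i \<inter> orbit_of f ` (\<Union>j\<in>I. \<Omega> j) = {}"
  proof (rule ccontr)
    assume "\<not> ?thesis"
    then obtain x y j where h: "x \<in> \<Omega> i" "y \<in> \<Omega> j" "j \<in> I" "orbit_of f x = orbit_of f y" by auto
    have "x \<in> \<Omega> j"
      using self_in_orbit_of[of x f] orbit_of_subset[of f "\<Omega> j" y] insert.prems(1)[of j] h by auto
    then show False using insert.prems(2)[of i j] insert.hyps h by auto
  qed
  then show ?case
    using insert by (simp add: cycle_type_altdef image_Un mset_set_Union)
qed

lemma orbit_of_conj:
  assumes "\<And>x. h (f x) = g (h x)"
  shows "orbit_of g (h x) = h ` orbit_of f x"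
proof -
  have "(g ^^ n) (h x) = h ((f ^^ n) x)" for n by (induction n) (simp_all add: assms)
  then show ?thesis by (auto simp: orbit_of_def)
qed

text \<open>Serves to identify a fibre with the factor it copies and, at the end, the vector space
  with a product.\<close>

lemma cycle_type_conj:
  assumes h: "inj h" and c: "\<And>x. h (f x) = g (h x)"
  shows "cycle_type g (h ` \<Omega>) = cycle_type f \<Omega>"
proof -
  have "orbit_of g ` h ` \<Omega> = (`) h ` orbit_of f ` \<Omega>"
    by (simp add: image_image orbit_of_conj[of h f g, OF c])
  moreover have "inj_on ((`) h) X" for X using h by (simp add: inj_on_def inj_image_eq_iff)
  ultimately show ?thesis
    unfolding cycle_type_altdef
    by (simp add: image_mset_mset_set[symmetric] multiset.map_comp o_def card_image[OF inj_on_subset[OF h subset_UNIV]])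
qed

text \<open>Every orbit of \<open>G\<close> that meets \<open>S\<close> meets it in exactly one
  orbit of the first return map \<open>G ^^ l\<close>. The \<open>l\<close> images of the latter
  under \<open>G ^^ k\<close> with \<open>k < l\<close> are disjoint and fill the orbit of
  \<open>G\<close>, whence the factor \<open>l\<close>.\<close>

lemma cycle_type_return_map:
  fixes G :: "'b::finite \<Rightarrow> 'b"
  assumes G: "inj G" and l: "l > 0" and S: "\<And>x. x \<in> S \<Longrightarrow> (G ^^ l) x \<in> S"
    and first: "\<And>x k. x \<in> S \<Longrightarrow> 0 < k \<Longrightarrow> k < l \<Longrightarrow> (G ^^ k) x \<notin> S"
  shows "cycle_type G (\<Union>k<l. (G ^^ k) ` S) = BU l (cycle_type (G ^^ l) S)"
proof -
  let ?\<Omega> = "\<Union>k<l. (G ^^ k) ` S"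
  have Sq: "((G ^^ l) ^^ q) x \<in> S" if "x \<in> S" for q x
    by (induction q) (use that S in auto)
  \<comment> \<open>Division by \<open>l\<close>: first whole returns inside \<open>S\<close>, then
    fewer than \<open>l\<close> further steps.\<close>
  have split: "(G ^^ n) x = (G ^^ (n mod l)) (((G ^^ l) ^^ (n div l)) x)" for n x
    by (metis comp_apply funpow_add funpow_mult mod_mult_div_eq mult.commute)
  have orbs: "orbit_of G ` ?\<Omega> = orbit_of G ` S"
  proof -
    have "orbit_of G ((G ^^ k) x) = orbit_of G x" for k x
      by (rule orbit_of_eq[OF G]) (auto simp: orbit_of_def)
    then show ?thesis using l by (force simp: image_iff)
  qed
  have int: "orbit_of G x \<inter> S = orbit_of (G ^^ l) x" if x: "x \<in> S" for x
  proof
    show "orbit_of G x \<inter> S \<subseteq> orbit_of (G ^^ l) x"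
    proof
      fix y assume "y \<in> orbit_of G x \<inter> S"
      then obtain n where n: "y = (G ^^ n) x" "y \<in> S" by (auto simp: orbit_of_def)
      \<comment> \<open>A positive remainder would put \<open>y\<close> outside \<open>S\<close> by
        \<open>first\<close>.\<close>
      with split[of n x] have "n mod l = 0" using first[OF Sq[OF x], of "n mod l" "n div l"] l by auto
      then show "y \<in> orbit_of (G ^^ l) x" using n split[of n x] by (auto simp: orbit_of_def)
    qed
    show "orbit_of (G ^^ l) x \<subseteq> orbit_of G x \<inter> S"
      using Sq[OF x] by (auto simp: orbit_of_def funpow_mult)
  qed
  have disj: "(G ^^ i) ` S \<inter> (G ^^ j) ` S = {}" if "i < j" "j < l" for i j
  proof (rule ccontr)
    assume "\<not> ?thesis"
    then obtain s t where st: "s \<in> S" "t \<in> S" "(G ^^ i) s = (G ^^ j) t" by auto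
    have "(G ^^ j) t = (G ^^ i) ((G ^^ (j - i)) t)"
      using that(1) by (metis comp_apply funpow_add le_add_diff_inverse less_imp_le)
    then have "s = (G ^^ (j - i)) t" using st(3) inj_fn[OF G] by (metis injD)
    then show False using first[OF st(2), of "j - i"] st(1) that by auto
  qed
  have card: "card (orbit_of G x) = l * card (orbit_of G x \<inter> S)" if x: "x \<in> S" for x
  proof -
    let ?Q = "orbit_of (G ^^ l) x"
    have QS: "?Q \<subseteq> S" using int[OF x] by blast
    have "orbit_of G x = (\<Union>k<l. (G ^^ k) ` ?Q)"
    proof
      show "orbit_of G x \<subseteq> (\<Union>k<l. (G ^^ k) ` ?Q)"
      proof
        fix y assume "y \<in> orbit_of G x"
        then obtain n where "y = (G ^^ n) x" by (auto simp: orbit_of_def)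
        then have "y \<in> (G ^^ (n mod l)) ` ?Q" using split[of n x] by (auto simp: orbit_of_def)
        then show "y \<in> (\<Union>k<l. (G ^^ k) ` ?Q)" using l by auto
      qed
      have "?Q \<subseteq> orbit_of G x" using int[OF x] by blast
      moreover have "G ` orbit_of G x \<subseteq> orbit_of G x"
        by (auto simp: orbit_of_def) (metis comp_apply funpow.simps(2))
      then have "(G ^^ k) y \<in> orbit_of G x" if "y \<in> orbit_of G x" for k y
        by (induction k) (use that in auto)
      ultimately show "(\<Union>k<l. (G ^^ k) ` ?Q) \<subseteq> orbit_of G x" by auto
    qed
    also have "card \<dots> = (\<Sum>k<l. card ((G ^^ k) ` ?Q))"
    proof (rule card_UN_disjoint)
      show "\<forall>i\<in>{..<l}. \<forall>j\<in>{..<l}. i \<noteq> j \<longrightarrow> (G ^^ i) ` ?Q \<inter> (G ^^ j) ` ?Q = {}"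
      proof (intro ballI impI)
        fix i j assume "i \<in> {..<l}" "j \<in> {..<l}" "i \<noteq> j"
        then have "(G ^^ i) ` S \<inter> (G ^^ j) ` S = {}"
          using disj[of i j] disj[of j i] by (auto simp: Int_commute neq_iff)
        then show "(G ^^ i) ` ?Q \<inter> (G ^^ j) ` ?Q = {}" using QS by blast
      qed
    qed auto
    also have "\<dots> = l * card ?Q"
      by (simp add: card_image[OF inj_on_subset[OF inj_fn[OF G] subset_UNIV]])
    finally show ?thesis using int[OF x] by simp
  qed
  \<comment> \<open>Intersection with \<open>S\<close> matches the orbits of \<open>G\<close>
    through \<open>S\<close> with those of the return map.\<close>
  have orbs': "orbit_of (G ^^ l) ` S = (\<lambda>Q. Q \<inter> S) ` orbit_of G ` S"
    using int by (simp add: image_image)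
  have "inj_on (\<lambda>Q. Q \<inter> S) (orbit_of G ` S)"
  proof (rule inj_onI)
    fix P Q assume "P \<in> orbit_of G ` S" "Q \<in> orbit_of G ` S" and eq: "P \<inter> S = Q \<inter> S"
    then obtain x y where xy: "x \<in> S" "P = orbit_of G x" "Q = orbit_of G y" by auto
    then have "x \<in> orbit_of G y" using eq self_in_orbit_of[of x G] by auto
    then show "P = Q" using orbit_of_eq[OF G] xy by simp
  qed
  then have "cycle_type (G ^^ l) S = image_mset (\<lambda>Q. card (Q \<inter> S)) (mset_set (orbit_of G ` S))"
    unfolding cycle_type_altdef orbs' by (simp add: image_mset_mset_set[symmetric] multiset.map_comp o_def)
  then have "BU l (cycle_type (G ^^ l) S) = image_mset (\<lambda>Q. l * card (Q \<inter> S)) (mset_set (orbit_of G ` S))"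
    by (simp add: BU_def multiset.map_comp o_def)
  also have "\<dots> = image_mset card (mset_set (orbit_of G ` S))"
    using card by (intro image_mset_cong) auto
  finally show ?thesis unfolding cycle_type_altdef orbs by simp
qed

text \<open>\<open>A 0\<close> acts first: this is the order in which fibre maps are met when the
  base map is iterated.\<close>

primrec iter_comp :: "(nat \<Rightarrow> 'a \<Rightarrow> 'a) \<Rightarrow> nat \<Rightarrow> 'a \<Rightarrow> 'a" where
  "iter_comp A 0 = id"
| "iter_comp A (Suc n) = A n \<circ> iter_comp A n"

lemma iter_comp_cong: "(\<And>k. k < n \<Longrightarrow> A k = B k) \<Longrightarrow> iter_comp A n = iter_comp B n"
proof (induction n)
  case (Suc n)
  have "A n = B n" by (rule Suc.prems) simp
  moreover have "iter_comp A n = iter_comp B n" by (rule Suc.IH) (simp add: Suc.prems)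
  ultimately show ?case by simp
qed simp

text \<open>The fibre over \<open>u\<close> is first revisited after as many steps as its cycle is
  long, and the return map is the composition of the fibre maps met on the way.\<close>

lemma cycle_type_skew_orbit:
  fixes f :: "'u::finite \<Rightarrow> 'u" and A :: "'u \<Rightarrow> 'w::finite \<Rightarrow> 'w"
  assumes f: "inj f" and A: "\<And>u. inj (A u)"
  defines "G \<equiv> \<lambda>(w, u). (A u w, f u)"
  shows "cycle_type G (UNIV \<times> orbit_of f u) =
    BU (card (orbit_of f u)) (cycle_type (iter_comp (\<lambda>k. A ((f ^^ k) u)) (card (orbit_of f u))) UNIV)"
proof -
  define l where "l = card (orbit_of f u)"
  define \<sigma> where "\<sigma> = iter_comp (\<lambda>k. A ((f ^^ k) u))"
  note orb = orbit_of_enum[OF f, of u, folded l_def]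
  have G: "inj G" using f A by (auto simp: G_def intro!: injI dest!: injD)
  have pow: "(G ^^ k) (w, u) = (\<sigma> k w, (f ^^ k) u)" for k w
    by (induction k) (simp_all add: G_def \<sigma>_def)
  let ?S = "UNIV \<times> {u} :: ('w \<times> 'u) set"
  have "(f ^^ k) u \<noteq> u" if "0 < k" "k < l" for k
    using inj_onD[OF orb(3), of k 0] that by auto
  then have ret: "cycle_type G (\<Union>k<l. (G ^^ k) ` ?S) = BU l (cycle_type (G ^^ l) ?S)"
    using G orb(1,2) by (intro cycle_type_return_map) (auto simp: pow)
  have inj\<sigma>: "inj (\<sigma> k)" for k
  proof (induction k)
    case 0
    then show ?case by (simp add: \<sigma>_def)
  next
    case (Suc k)
    then show ?case using inj_compose[OF A[of "(f ^^ k) u"] Suc.IH] by (simp only: \<sigma>_def iter_comp.simps)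
  qed
  have "(\<Union>k<l. (G ^^ k) ` ?S) = UNIV \<times> orbit_of f u"
  proof -
    \<comment> \<open>\<open>\<sigma> k\<close> is onto, so the images of the fibre over
      \<open>u\<close> are whole fibres.\<close>
    have "(G ^^ k) ` ?S = UNIV \<times> {(f ^^ k) u}" for k
    proof -
      have "(G ^^ k) ` ?S = range (\<sigma> k) \<times> {(f ^^ k) u}" by (auto simp: pow image_iff)
      moreover have "range (\<sigma> k) = UNIV" using inj\<sigma> by (rule finite_UNIV_inj_surj[OF finite])
      ultimately show ?thesis by simp
    qed
    then show ?thesis unfolding orb(4) by auto
  qed
  moreover have "cycle_type (G ^^ l) ((\<lambda>w. (w, u)) ` UNIV) = cycle_type (\<sigma> l) UNIV"
    by (rule cycle_type_conj) (auto simp: inj_def pow orb(2))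
  moreover have "(\<lambda>w. (w, u)) ` UNIV = ?S" by auto
  ultimately show ?thesis using ret by (simp add: l_def \<sigma>_def)
qed

text \<open>The sequence \<open>As Q\<close> is laid along the cycle \<open>Q\<close>, starting at a
  chosen representative.\<close>

lemma skew_product_realization:
  fixes f :: "'u::finite \<Rightarrow> 'u" and As :: "'u set \<Rightarrow> nat \<Rightarrow> 'w::finite \<Rightarrow> 'w"
  assumes f: "inj f" and As: "\<And>Q k. Q \<in> range (orbit_of f) \<Longrightarrow> As Q k \<in> X" and X: "\<And>a. a \<in> X \<Longrightarrow> inj a"
  shows "\<exists>A. (\<forall>u. A u \<in> X) \<and> cycle_type (\<lambda>(w, u). (A u w, f u)) UNIV =
    (\<Sum>Q\<in>range (orbit_of f). BU (card Q) (cycle_type (iter_comp (As Q) (card Q)) UNIV))"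
proof -
  have "\<exists>x. orbit_of f x = Q" if "Q \<in> range (orbit_of f)" for Q using that by auto
  then obtain rep where rep: "\<And>Q. Q \<in> range (orbit_of f) \<Longrightarrow> orbit_of f (rep Q) = Q" by metis
  \<comment> \<open>The iterates of the representative recur; \<open>LEAST\<close> selects the
    position of \<open>u\<close> below the cycle length.\<close>
  define ind where "ind u = (LEAST k. (f ^^ k) (rep (orbit_of f u)) = u)" for u
  define A where "A u = As (orbit_of f u) (ind u)" for u
  have AX: "A u \<in> X" for u using As by (simp add: A_def)
  have A_eq: "A ((f ^^ k) (rep Q)) = As Q k" if Q: "Q \<in> range (orbit_of f)" and k: "k < card Q" for Q k
  proof -
    let ?u = "(f ^^ k) (rep Q)"
    have oQ: "orbit_of f ?u = Q" using rep[OF Q] orbit_of_eq[OF f, of ?u "rep Q"] by (auto simp: orbit_of_def)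
    have inj: "inj_on (\<lambda>k. (f ^^ k) (rep Q)) {..<card Q}" using orbit_of_enum(3)[OF f, of "rep Q"] rep[OF Q] by simp
    have "ind ?u = k"
      unfolding ind_def oQ
    proof (rule Least_equality)
      fix j assume "(f ^^ j) (rep Q) = ?u"
      then show "k \<le> j" using inj_onD[OF inj, of j k] k by (metis lessThan_iff linorder_not_le order.strict_trans order.refl)
    qed simp
    then show ?thesis by (simp add: A_def oQ)
  qed
  let ?G = "\<lambda>(w, u). (A u w, f u)"
  have "(UNIV :: ('w \<times> 'u) set) = (\<Union>Q\<in>range (orbit_of f). UNIV \<times> Q)"
    using self_in_orbit_of[of _ f] by auto
  then have "cycle_type ?G UNIV = cycle_type ?G (\<Union>Q\<in>range (orbit_of f). UNIV \<times> Q)" by simp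
  also have "\<dots> = (\<Sum>Q\<in>range (orbit_of f). cycle_type ?G (UNIV \<times> Q))"
  proof (rule cycle_type_UN)
    fix Q assume "Q \<in> range (orbit_of f)"
    then obtain x where Q: "Q = orbit_of f x" by auto
    have "f y \<in> Q" if y: "y \<in> Q" for y
    proof -
      obtain n where "y = (f ^^ n) x" using y unfolding Q orbit_of_def by blast
      then have "f y = (f ^^ Suc n) x" by simp
      then show ?thesis unfolding Q orbit_of_def by blast
    qed
    then show "?G ` (UNIV \<times> Q) \<subseteq> UNIV \<times> Q" by auto
  next
    fix P Q assume PQ: "P \<in> range (orbit_of f)" "Q \<in> range (orbit_of f)" "P \<noteq> Q"
    have "P \<inter> Q = {}"
    proof (rule ccontr)
      assume "P \<inter> Q \<noteq> {}"
      then obtain z where "z \<in> P" "z \<in> Q" by auto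
      then show False using PQ orbit_of_eq[OF f] by (metis rangeE)
    qed
    then show "(UNIV :: 'w set) \<times> P \<inter> UNIV \<times> Q = {}" by auto
  qed simp
  also have "\<dots> = (\<Sum>Q\<in>range (orbit_of f). BU (card Q) (cycle_type (iter_comp (As Q) (card Q)) UNIV))"
  proof (rule sum.cong)
    fix Q assume Q: "Q \<in> range (orbit_of f)"
    have "cycle_type ?G (UNIV \<times> Q) = BU (card Q) (cycle_type (iter_comp (\<lambda>k. A ((f ^^ k) (rep Q))) (card Q)) UNIV)"
      using cycle_type_skew_orbit[where u = "rep Q" and A = A, OF f X[OF AX]] rep[OF Q] by simp
    also have "iter_comp (\<lambda>k. A ((f ^^ k) (rep Q))) (card Q) = iter_comp (As Q) (card Q)"
      by (rule iter_comp_cong) (rule A_eq[OF Q])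
    finally show "cycle_type ?G (UNIV \<times> Q) = BU (card Q) (cycle_type (iter_comp (As Q) (card Q)) UNIV)" .
  qed simp
  finally show ?thesis using AX by blast
qed

text \<open>\<open>\<iota>\<close> numbers the cycles of each length \<open>l\<close> from 1 to
  their multiplicity in the cycle type; this distributes the index pairs \<open>(l, i)\<close> over
  the cycles of \<open>f\<close>.\<close>

lemma sum_over_cycles:
  fixes f :: "'u::finite \<Rightarrow> 'u" and F :: "nat \<Rightarrow> nat \<Rightarrow> 'b::comm_monoid_add"
  assumes f: "inj f"
  shows "\<exists>\<iota>. (\<forall>Q\<in>range (orbit_of f). card Q \<in> {1..CARD('u)} \<and> \<iota> Q \<in> {1..count (cycle_type f UNIV) (card Q)}) \<and>
    (\<Sum>Q\<in>range (orbit_of f). F (card Q) (\<iota> Q)) =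
    (\<Sum>l\<in>{1..CARD('u)}. \<Sum>i\<in>{1..count (cycle_type f UNIV) l}. F l i)"
proof -
  let ?O = "range (orbit_of f)" and ?c = "count (cycle_type f UNIV)"
  have "card {Q\<in>?O. card Q = l} = ?c l" for l
    unfolding cycle_type_altdef by (simp add: count_image_mset_eq_card_vimage conj_commute)
  then have "\<exists>h. bij_betw h {Q\<in>?O. card Q = l} {1..?c l}" for l
    by (intro finite_same_card_bij) auto
  then obtain h where h: "\<And>l. bij_betw (h l) {Q\<in>?O. card Q = l} {1..?c l}" by metis
  define \<iota> where "\<iota> Q = h (card Q) Q" for Q
  have c: "card Q \<in> {1..CARD('u)}" if "Q \<in> ?O" for Q
    using that orbit_of_enum(1)[OF f] by (auto simp: card_mono Suc_le_eq)
  have "\<iota> Q \<in> {1..?c (card Q)}" if "Q \<in> ?O" for Q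
    using bij_betwE[OF h[of "card Q"]] that unfolding \<iota>_def by blast
  moreover have "(\<Sum>Q\<in>?O. F (card Q) (\<iota> Q)) = (\<Sum>l\<in>{1..CARD('u)}. \<Sum>i\<in>{1..?c l}. F l i)"
  proof -
    have "(\<Sum>Q\<in>?O. F (card Q) (\<iota> Q)) = (\<Sum>l\<in>{1..CARD('u)}. \<Sum>Q\<in>{Q\<in>?O. card Q = l}. F (card Q) (\<iota> Q))"
      using c by (intro sum.group[symmetric]) auto
    also have "\<dots> = (\<Sum>l\<in>{1..CARD('u)}. \<Sum>Q\<in>{Q\<in>?O. card Q = l}. F l (h l Q))"
      by (intro sum.cong) (auto simp: \<iota>_def)
    also have "\<dots> = (\<Sum>l\<in>{1..CARD('u)}. \<Sum>i\<in>{1..?c l}. F l i)"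
      by (intro sum.cong refl sum.reindex_bij_betw h)
    finally show ?thesis .
  qed
  ultimately show ?thesis using c by blast
qed

lemma card_orbit_of_dvd:
  fixes f :: "'a::finite \<Rightarrow> 'a"
  assumes f: "inj f" and n: "(f ^^ n) x = x"
  shows "card (orbit_of f x) dvd n"
proof (rule ccontr)
  let ?l = "card (orbit_of f x)"
  note orb = orbit_of_enum[OF f, of x]
  assume "\<not> ?l dvd n"
  then have "0 < n mod ?l" by (simp add: dvd_eq_mod_eq_0)
  moreover have "(f ^^ (n mod ?l)) x = (f ^^ 0) x" using funpow_mod_eq[OF orb(2), of n] n by simp
  then have "n mod ?l = 0" by (rule inj_onD[OF orb(3)]) (use orb(1) in auto)
  ultimately show False by simp
qed

text \<open>Meant for the identity and for translations, where the orbits partition the space into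
  sets of equal size.\<close>

lemma cycle_type_uniform:
  fixes f :: "'a::finite \<Rightarrow> 'a"
  assumes f: "inj f" and k: "\<And>x. card (orbit_of f x) = k"
  shows "cycle_type f UNIV = replicate_mset (CARD('a) div k) k"
proof -
  let ?O = "range (orbit_of f)"
  have "k > 0" using orbit_of_enum(1)[OF f] k by metis
  have "\<Union> ?O = UNIV" using self_in_orbit_of[of _ f] by auto
  moreover have "card (\<Union> ?O) = sum card ?O"
  proof (rule card_Union_disjoint)
    show "pairwise disjnt ?O"
      unfolding pairwise_def disjnt_def using orbit_of_eq[OF f] by (metis disjoint_iff rangeE)
  qed auto
  moreover have "sum card ?O = sum (\<lambda>_. k) ?O" by (rule sum.cong) (use k in auto)
  ultimately have "CARD('a) = card ?O * k" by simp
  then have "card ?O = CARD('a) div k" using \<open>k > 0\<close> by simp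
  moreover have "cycle_type f UNIV = image_mset (\<lambda>_. k) (mset_set ?O)"
    unfolding cycle_type_altdef using k by (intro image_mset_cong) auto
  ultimately show ?thesis by (simp add: image_mset_const_eq)
qed

section \<open>Products of matrices without eigenvalue -1\<close>

lemma invertible_iff_row_kernel:
  fixes A :: "'a::field^'n^'n"
  shows "invertible A \<longleftrightarrow> (\<forall>x. x v* A = 0 \<longrightarrow> x = 0)"
proof -
  have "invertible A \<longleftrightarrow> (\<exists>B. B ** transpose A = mat 1)"
    by (simp add: invertible_right_inverse left_invertible_transpose)
  then show ?thesis by (simp add: matrix_left_invertible_ker)
qed

lemma matrix_eq_row: "(\<And>x. x v* A = x v* B) \<Longrightarrow> A = (B :: 'a::field^'n^'n)"
  by (metis matrix_eq transpose_matrix_vector transpose_transpose)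

lemma vlin_row_mult: "vlin (\<lambda>x. x v* M)"
  by (intro vlinI) (simp_all add: vector_matrix_left_distrib scalar_vector_matrix_assoc)

lemma lam_comp: "lam B w \<circ> lam A v = lam (A ** B) (v v* B + w)"
  by (auto simp: lam_def vector_matrix_mul_assoc[symmetric] vector_matrix_left_distrib)

lemma inj_lam: "invertible A \<Longrightarrow> inj (lam A v)"
  unfolding invertible_iff_row_kernel
  by (rule injI) (metis add_right_cancel eq_iff_diff_eq_0 lam_def vector_matrix_mult_diff_distrib)

lemma CGL_iff: "A \<in> CGL \<longleftrightarrow> invertible A \<and> (\<forall>x. x v* A + x = 0 \<longrightarrow> x = 0)"
  unfolding CGL_def by (auto simp: eq_neg_iff_add_eq_0)

text \<open>Separation on the whole space, for the identity and \<open>x \<mapsto> x v* M\<close>,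
  yields \<open>N\<close>; \<open>A\<close> represents \<open>N\<close> on row vectors and
  \<open>B\<close> is the quotient \<open>A' ** M\<close>.\<close>

lemma CGL_two_factors:
  fixes M :: "'p::prime_card mod_ring^'d^'d"
  assumes M: "invertible M"
    and ex: "\<not> (CARD('d) = 1 \<and> CARD('p) = 2)" "\<not> (CARD('d) = 1 \<and> CARD('p) = 3)" "\<not> (CARD('d) = 2 \<and> CARD('p) = 2)"
  shows "\<exists>A\<in>CGL. \<exists>B\<in>CGL. M = A ** B"
proof -
  have "separable_dim TYPE('p mod_ring^'d) CARD('d)" by (rule separable_dim_mod_ring[OF ex]) simp
  then have "separable (UNIV :: ('p mod_ring^'d) set) UNIV (\<lambda>x. x) (\<lambda>x. x v* M)"
    unfolding separable_dim_def
    by (elim allE[of _ UNIV] allE[of _ "\<lambda>x. x"] allE[of _ "\<lambda>x. x v* M"] mp)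
      (simp only: vec_dim_card vec.subspace_UNIV vlin_row_mult, simp add: vec.linear_ident)
  then obtain N where N: "vlin N" and N0: "\<And>x. x \<noteq> 0 \<Longrightarrow> N x \<noteq> 0 \<and> N x + x \<noteq> 0 \<and> N x + x v* M \<noteq> 0"
    unfolding separable_def by auto
  \<comment> \<open>Transposed because \<open>matrix N\<close> represents the action on
    columns.\<close>
  define A where "A = transpose (matrix N)"
  have A: "x v* A = N x" for x by (simp add: A_def matrix_works[OF N])
  have iA: "invertible A" unfolding invertible_iff_row_kernel A using N0 by blast
  then obtain A' where A': "A ** A' = mat 1" "A' ** A = mat 1" unfolding invertible_def by blast
  define B where "B = A' ** M"
  have AB: "A ** B = M" by (simp add: B_def matrix_mul_assoc A'(1))
  have "A \<in> CGL" unfolding CGL_iff A using iA N0 by blast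
  moreover have "B \<in> CGL"
    unfolding CGL_iff
  proof (intro conjI allI impI)
    have "invertible A'" unfolding invertible_def using A' by blast
    then show "invertible B" using M unfolding B_def by (rule invertible_mult)
    fix x assume x: "x v* B + x = 0"
    \<comment> \<open>Writing \<open>x = y v* A\<close> turns \<open>x v* B + x = 0\<close> into
      \<open>N y + y v* M = 0\<close>.\<close>
    define y where "y = x v* A'"
    have yA: "y v* A = x" by (simp add: y_def vector_matrix_mul_assoc A'(2))
    have "N y + y v* M = 0" using x yA A[of y] by (simp add: B_def y_def vector_matrix_mul_assoc add.commute)
    then have "y = 0" using N0 by blast
    then show "x = 0" using yA by simp
  qed
  ultimately show ?thesis using AB by blast
qed

text \<open>Induction on \<open>l\<close>: two factors come from \<open>two\<close>, and each
  further one is \<open>C\<close>, split off on the right. The set \<open>T\<close> is kept variable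
  because for (d, p) = (1, 3) and (2, 2) not every invertible matrix is a product of two members of
  \<open>CGL\<close>.\<close>

lemma iter_comp_lam:
  fixes T :: "('a::field^'n^'n) set"
  assumes two: "\<And>M. M \<in> T \<Longrightarrow> \<exists>A\<in>CGL. \<exists>B\<in>CGL. M = A ** B"
    and C: "C \<in> CGL" and step: "\<And>M. M \<in> T \<Longrightarrow> \<exists>M'\<in>T. M = M' ** C"
    and l: "2 \<le> l" and M: "M \<in> T"
  shows "\<exists>As. (\<forall>k. As k \<in> ACGL) \<and> iter_comp As l = lam M v"
  using l M
proof (induction arbitrary: M v rule: dec_induct)
  case base
  then obtain A B where AB: "A \<in> CGL" "B \<in> CGL" "M = A ** B" using two by blast
  \<comment> \<open>With row vectors the map applied first contributes the left factor. The whole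
    translation is put into the last map.\<close>
  let ?As = "\<lambda>k::nat. if k = 0 then lam A 0 else lam B v"
  have "iter_comp ?As 2 = lam M v" using AB by (simp add: numeral_2_eq_2 lam_comp)
  moreover have "\<forall>k. ?As k \<in> ACGL" using AB by (auto simp: ACGL_def)
  ultimately show ?case by (intro exI[of _ ?As]) simp
next
  case (step l)
  then obtain M' where M': "M' \<in> T" "M = M' ** C" using assms(3) by blast
  then obtain As where As: "\<forall>k. As k \<in> ACGL" "iter_comp As l = lam M' 0" using step.IH by blast
  let ?As = "\<lambda>k. if k < l then As k else lam C v"
  have "iter_comp ?As l = iter_comp As l" by (rule iter_comp_cong) simp
  then have "iter_comp ?As (Suc l) = lam M v" using As(2) M'(2) by (simp add: lam_comp)
  moreover have "\<forall>k. ?As k \<in> ACGL" using As(1) C by (auto simp: ACGL_def)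
  ultimately show ?case by (intro exI[of _ ?As]) simp
qed

text \<open>\<open>n\<close> steps add \<open>n\<close> times \<open>v\<close>, which is 0 exactly
  when the characteristic divides \<open>n\<close>.\<close>

lemma cycle_type_translation:
  fixes v :: "'p::prime_card mod_ring ^ 'd"
  assumes v: "v \<noteq> 0"
  shows "cycle_type (lam (mat 1) v) UNIV = replicate_mset (CARD('p) ^ CARD('d) div CARD('p)) CARD('p)"
proof -
  have inj: "inj (lam (mat 1) v)" by (simp add: lam_def inj_def)
  have pow: "(lam (mat 1) v ^^ n) x = x + of_nat n *s v" for n x
    by (induction n) (simp_all add: lam_def vec.scale_left_distrib ac_simps)
  have "card (orbit_of (lam (mat 1) v) x) = CARD('p)" for x
  proof -
    have "of_nat (card (orbit_of (lam (mat 1) v) x)) *s v = 0"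
      using orbit_of_enum(2)[OF inj, of x] by (simp add: pow)
    then have "CARD('p) dvd card (orbit_of (lam (mat 1) v) x)"
      using v of_nat_0_mod_ring_dvd by (metis vec.scale_eq_0_iff)
    moreover have "card (orbit_of (lam (mat 1) v) x) dvd CARD('p)"
      by (rule card_orbit_of_dvd[OF inj]) (simp add: pow)
    ultimately show ?thesis using dvd_antisym by blast
  qed
  then show ?thesis using cycle_type_uniform[OF inj] by simp
qed

lemma cycle_type_identity:
  "cycle_type (lam (mat 1) (0 :: 'p::prime_card mod_ring ^ 'd)) UNIV = replicate_mset (CARD('p) ^ CARD('d)) 1"
proof -
  have id: "lam (mat 1) (0 :: 'p mod_ring ^ 'd) = id" by (auto simp: lam_def)
  have "orbit_of id x = {x}" for x :: "'p mod_ring ^ 'd" by (auto simp: orbit_of_def)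
  then show ?thesis unfolding id by (subst cycle_type_uniform[of _ 1]) auto
qed

text \<open>\<open>\<omega>\<close> is multiplication by a primitive cube root of unity on the field
  with four elements, viewed as F_2^2.\<close>

lemma order_3_matrix:
  assumes d: "CARD('d) = 2" and p: "CARD('p::prime_card) = 2"
  obtains \<omega> :: "'p::prime_card mod_ring ^ 'd ^ 'd"
    where "\<omega> \<in> CGL" "\<omega> ** \<omega> \<in> CGL" "\<omega> ** \<omega> ** \<omega> = mat 1"
proof -
  obtain i j :: 'd where ij: "i \<noteq> j" "UNIV = {i, j}" using d by (metis card_2_iff)
  have all: "(\<forall>k. P k) \<longleftrightarrow> P i \<and> P j" for P using ij by (metis UNIV_I empty_iff insert_iff)
  have sum2: "sum h UNIV = h i + h j" for h :: "'d \<Rightarrow> 'p mod_ring" unfolding ij(2) using ij(1) by simp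
  define \<omega> :: "'p mod_ring ^ 'd ^ 'd" where "\<omega> = (\<chi> r c. if r = i \<and> c = i then 0 else 1)"
  have \<omega>: "(x v* \<omega>) $ i = x $ j" "(x v* \<omega>) $ j = x $ i + x $ j" for x
    using ij(1) by (simp_all add: vector_matrix_mult_def \<omega>_def sum2)
  have two: "(2 :: 'p mod_ring) = 0" using of_nat_card_eq_0[where 'a='p] p by simp
  then have add: "a + a = 0" for a :: "'p mod_ring" by (metis mult_2 mult_zero_left)
  have cube: "\<omega> ** \<omega> ** \<omega> = mat 1"
  proof (rule matrix_eq_row)
    fix x :: "'p mod_ring ^ 'd"
    have "x v* \<omega> v* \<omega> v* \<omega> = x"
      unfolding vec_eq_iff all \<omega> using add[of "x $ j"] add[of "x $ i + x $ j"] by (simp add: algebra_simps)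
    then show "x v* (\<omega> ** \<omega> ** \<omega>) = x v* mat 1" by (simp add: vector_matrix_mul_assoc)
  qed
  have inv: "invertible \<omega>"
    unfolding invertible_iff_row_kernel vec_eq_iff all \<omega> by auto
  have "\<omega> \<in> CGL"
    unfolding CGL_iff using inv by (auto simp: vec_eq_iff all \<omega> add.assoc two)
  moreover have "\<omega> ** \<omega> \<in> CGL"
    unfolding CGL_iff using invertible_mult[OF inv inv]
    by (auto simp: vector_matrix_mul_assoc[symmetric] vec_eq_iff all \<omega> algebra_simps two)
  ultimately show thesis using that cube by blast
qed

text \<open>Since -1 = 1, membership in \<open>CGL\<close> excludes nonzero fixed vectors, so the
  three nonzero vectors form a single cycle.\<close>

lemma cycle_type_order_3:
  fixes \<omega> :: "'p::prime_card mod_ring ^ 'd ^ 'd"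
  assumes d: "CARD('d) = 2" and p: "CARD('p) = 2"
    and \<omega>: "\<omega> \<in> CGL" and cube: "\<omega> ** \<omega> ** \<omega> = mat 1"
  shows "cycle_type (lam \<omega> 0) UNIV = {#1, 3#}"
proof -
  let ?f = "lam \<omega> 0"
  have inj: "inj ?f" using \<omega> by (auto simp: CGL_def intro: inj_lam)
  have "(2 :: 'p mod_ring) = 0" using of_nat_card_eq_0[where 'a='p] p by simp
  then have add: "x + x = 0" for x :: "'p mod_ring ^ 'd" by (simp add: vec_eq_iff)
  have fixed: "x = 0" if "?f x = x" for x
  proof -
    have "x v* \<omega> + x = 0" using that add[of x] by (simp add: lam_def)
    then show ?thesis using \<omega> unfolding CGL_iff by blast
  qed
  have "(?f ^^ n) 0 = 0" for n by (induction n) (simp_all add: lam_def)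
  then have o0: "orbit_of ?f 0 = {0}" by (auto simp: orbit_of_def)
  have "card (- {0 :: 'p mod_ring ^ 'd}) = 3" using d p by (simp add: Compl_eq_Diff_UNIV)
  have o: "orbit_of ?f x = - {0}" if x: "x \<noteq> 0" for x
  proof -
    have "(?f ^^ 3) x = x v* \<omega> v* \<omega> v* \<omega>" by (simp add: numeral_3_eq_3 lam_def)
    then have "(?f ^^ 3) x = x" by (simp add: vector_matrix_mul_assoc cube)
    then have "card (orbit_of ?f x) dvd 3" by (rule card_orbit_of_dvd[OF inj])
    moreover have "card (orbit_of ?f x) \<noteq> 1" using orbit_of_enum(2)[OF inj, of x] fixed[of x] x by auto
    ultimately have "card (orbit_of ?f x) = 3" using prime_nat_iff[of 3] by auto
    moreover have "0 \<notin> orbit_of ?f x" using orbit_of_eq[OF inj, of 0 x] o0 self_in_orbit_of[of x ?f] x by auto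
    ultimately show ?thesis using \<open>card (- {0}) = 3\<close> by (intro card_subset_eq) auto
  qed
  have "range (orbit_of ?f) = {{0}, - {0}}"
  proof
    have "orbit_of ?f x \<in> {{0}, - {0}}" for x by (cases "x = 0") (simp_all add: o o0)
    then show "range (orbit_of ?f) \<subseteq> {{0}, - {0}}" by blast
    have "- {0 :: 'p mod_ring ^ 'd} \<noteq> {}" using \<open>card (- {0}) = 3\<close> by auto
    then obtain x :: "'p mod_ring ^ 'd" where "x \<noteq> 0" by auto
    then show "{{0}, - {0}} \<subseteq> range (orbit_of ?f)" using o o0 by (metis empty_subsetI insert_subset rangeI)
  qed
  moreover have "{0 :: 'p mod_ring ^ 'd} \<noteq> - {0}" by auto
  ultimately show ?thesis using \<open>card (- {0}) = 3\<close> by (simp add: cycle_type_altdef)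
qed

text \<open>For \<open>l = 1\<close> this is the definition. For larger \<open>l\<close> the set of
  linear parts given to \<open>iter_comp_lam\<close> is \<open>{mat 1}\<close> if (d, p) = (1, 3), a
  group of order 3 if (d, p) = (2, 2), and all invertible matrices in the regular case.\<close>

lemma Gamma_realization:
  fixes \<gamma> :: "nat multiset"
  assumes \<gamma>: "\<gamma> \<in> Gamma TYPE('p::prime_card mod_ring ^ 'd) l" and l: "l \<ge> 1"
  shows "\<exists>As :: nat \<Rightarrow> 'p mod_ring ^ 'd \<Rightarrow> _. (\<forall>k. As k \<in> ACGL) \<and> cycle_type (iter_comp As l) UNIV = \<gamma>"
proof (cases "l = 1")
  case True
  then obtain \<sigma> :: "'p mod_ring ^ 'd \<Rightarrow> _" where "\<sigma> \<in> ACGL" "\<gamma> = cycle_type \<sigma> UNIV"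
    using \<gamma> by (auto simp: Gamma_def CTset_def)
  then show ?thesis using True by (intro exI[of _ "\<lambda>_. \<sigma>"]) simp
next
  case False
  then have l2: "2 \<le> l" using l by simp
  have *: ?thesis
    if T: "M \<in> T" and two: "\<And>M. M \<in> T \<Longrightarrow> \<exists>A\<in>CGL. \<exists>B\<in>CGL. M = A ** B" and C: "C \<in> CGL"
      and step: "\<And>M. M \<in> T \<Longrightarrow> \<exists>M'\<in>T. M = M' ** C" and c: "cycle_type (lam M v) UNIV = \<gamma>"
    for T M C and v :: "'p mod_ring ^ 'd"
    using iter_comp_lam[OF two C step l2 T, of v] c by metis
  obtain v :: "'p mod_ring ^ 'd" where v: "v \<noteq> 0"
    using that[of "\<chi> i. 1"] by (auto simp: vec_eq_iff)
  consider "CARD('d) = 1" "CARD('p) = 2" | "CARD('d) = 1" "CARD('p) = 3" | "CARD('d) = 2" "CARD('p) = 2"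
    | "\<not> (CARD('d) = 1 \<and> CARD('p) = 2)" "\<not> (CARD('d) = 1 \<and> CARD('p) = 3)" "\<not> (CARD('d) = 2 \<and> CARD('p) = 2)"
    by blast
  then show ?thesis
  proof cases
    case 1
    then show ?thesis using \<gamma> False by (simp add: Gamma_def)
  next
    case 2
    have "(2 :: 'p mod_ring) \<noteq> 0" using mod_ring_of_int_eq_0_iff[of 2, where 'p='p] 2 by simp
    \<comment> \<open>Over F_3 the identity matrix has no eigenvalue -1 because 2 is nonzero; the
      identity map and a nonzero translation then realize the two monomials.\<close>
    have C: "mat 1 \<in> (CGL :: ('p mod_ring ^ 'd ^ 'd) set)"
      unfolding CGL_iff
    proof (intro conjI allI impI)
      show "invertible (mat 1 :: 'p mod_ring ^ 'd ^ 'd)" by (auto simp: invertible_def)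
      fix x :: "'p mod_ring ^ 'd" assume "x v* mat 1 + x = 0"
      then have "2 * x $ i = 0" for i by (auto simp: vec_eq_iff)
      then show "x = 0" using \<open>(2 :: 'p mod_ring) \<noteq> 0\<close> by (simp add: vec_eq_iff)
    qed
    have "\<gamma> = {#1, 1, 1#} \<or> \<gamma> = {#3#}" using \<gamma> False 2 by (simp add: Gamma_def)
    then have "\<exists>v. cycle_type (lam (mat 1) (v :: 'p mod_ring ^ 'd)) UNIV = \<gamma>"
    proof (elim disjE)
      assume "\<gamma> = {#1, 1, 1#}"
      then show ?thesis
        using 2 by (intro exI[of _ 0]) (simp add: cycle_type_identity numeral_3_eq_3)
    next
      assume "\<gamma> = {#3#}"
      then show ?thesis
        using 2 by (intro exI[of _ v]) (simp add: cycle_type_translation[OF v])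
    qed
    then obtain v where "cycle_type (lam (mat 1) (v :: 'p mod_ring ^ 'd)) UNIV = \<gamma>" by blast
    with C show ?thesis by (intro *[of "mat 1" "{mat 1}" "mat 1"]) (auto intro!: bexI[of _ "mat 1"])
  next
    case 3
    then obtain \<omega> :: "'p mod_ring ^ 'd ^ 'd"
      where \<omega>: "\<omega> \<in> CGL" "\<omega> ** \<omega> \<in> CGL" and cube: "\<omega> ** \<omega> ** \<omega> = mat 1"
      using order_3_matrix by blast
    let ?T = "{mat 1, \<omega>, \<omega> ** \<omega>}"
    have cube': "\<omega> ** (\<omega> ** \<omega>) = mat 1" using cube by (simp add: matrix_mul_assoc)
    \<comment> \<open>\<open>\<omega>\<close> is its own fourth power; the other members of
      \<open>?T\<close> are \<open>\<omega>\<close> times \<open>\<omega> ** \<omega>\<close> and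
      \<open>\<omega>\<close> times \<open>\<omega>\<close>.\<close>
    have "\<omega> = (\<omega> ** \<omega>) ** (\<omega> ** \<omega>)" by (metis cube matrix_mul_assoc matrix_mul_lid)
    then have two: "\<exists>A\<in>CGL. \<exists>B\<in>CGL. M = A ** B" if "M \<in> ?T" for M
      using that \<omega> cube' by (metis empty_iff insert_iff)
    have step: "\<exists>M'\<in>?T. M = M' ** \<omega>" if "M \<in> ?T" for M
      using that cube by (metis insert_iff matrix_mul_lid empty_iff)
    have "\<gamma> = {#1, 1, 1, 1#} \<or> \<gamma> = {#2, 2#} \<or> \<gamma> = {#1, 3#}" using \<gamma> False 3 by (simp add: Gamma_def)
    then have "\<exists>M\<in>?T. \<exists>v. cycle_type (lam M v) UNIV = \<gamma>"
    proof (elim disjE)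
      assume "\<gamma> = {#1, 1, 1, 1#}"
      then have "cycle_type (lam (mat 1) (0 :: 'p mod_ring ^ 'd)) UNIV = \<gamma>"
        using 3 by (simp add: cycle_type_identity numeral_eq_Suc)
      then show ?thesis by blast
    next
      assume "\<gamma> = {#2, 2#}"
      \<comment> \<open>Over F_2 a nonzero translation is an involution without fixed points on the
        four vectors.\<close>
      then have "cycle_type (lam (mat 1) v) UNIV = \<gamma>"
        using 3 replicate_mset_Suc[of 1 "2::nat"]
        by (simp add: cycle_type_translation[OF v] power2_eq_square flip: numeral_2_eq_2)
      then show ?thesis by blast
    next
      assume "\<gamma> = {#1, 3#}"
      then have "cycle_type (lam \<omega> 0) UNIV = \<gamma>" using cycle_type_order_3[OF 3 \<omega>(1) cube] by simp
      then show ?thesis by blast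
    qed
    then show ?thesis using *[OF _ two \<omega>(1) step] by blast
  next
    case 4
    then have "\<gamma> \<in> CTset (AGL :: ('p mod_ring ^ 'd \<Rightarrow> _) set)" using \<gamma> False by (auto simp: Gamma_def)
    then obtain M v where M: "invertible M" "cycle_type (lam M (v :: 'p mod_ring ^ 'd)) UNIV = \<gamma>"
      by (auto simp: CTset_def AGL_def)
    have two: "\<exists>A\<in>CGL. \<exists>B\<in>CGL. M = A ** B" if "M \<in> {M. invertible M}" for M :: "'p mod_ring ^ 'd ^ 'd"
      using CGL_two_factors[of M] 4 that by blast
    \<comment> \<open>Any factor supplied by \<open>two\<close> serves as \<open>C\<close>; dividing
      by it on the right stays among the invertible matrices.\<close>
    then obtain C :: "'p mod_ring ^ 'd ^ 'd" where C: "C \<in> CGL" using M(1) by blast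
    then obtain C' where C': "C ** C' = mat 1" "C' ** C = mat 1" by (auto simp: CGL_def invertible_def)
    have step: "\<exists>M'\<in>{M. invertible M}. M = M' ** C" if "M \<in> {M. invertible M}" for M
    proof
      show "M = M ** C' ** C" by (simp add: matrix_mul_assoc[symmetric] C')
      have "invertible C'" using C' by (auto simp: invertible_def)
      then show "M ** C' \<in> {M. invertible M}" using that by (simp add: invertible_mult)
    qed
    show ?thesis using *[OF _ two C step M(2)] M(1) by blast
  qed
qed

section \<open>Coset-wise affine complete mappings\<close>

text \<open>The second map has linear part \<open>A + 1\<close>, which is injective because -1 is
  not an eigenvalue of \<open>A\<close>.\<close>

lemma ACGL_D:
  assumes "a \<in> ACGL"
  shows "inj a" "inj (\<lambda>x. a x + x)"
proof -
  obtain A v where A: "A \<in> CGL" "a = lam A v" using assms by (auto simp: ACGL_def)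
  then show "inj a" by (auto simp: CGL_def intro: inj_lam)
  show "inj (\<lambda>x. a x + x)"
  proof (rule injI)
    fix x y assume "a x + x = a y + y"
    then have "(x - y) v* A + (x - y) = 0"
      by (simp add: A lam_def vector_matrix_mult_diff_distrib algebra_simps)
    then show "x = y" using A(1) unfolding CGL_iff by (metis eq_iff_diff_eq_0)
  qed
qed

text \<open>A basis \<open>B\<close> of \<open>W\<close> extends to a basis \<open>B'\<close> of the
  space; \<open>\<phi>\<close> is built from \<open>B\<close> and \<open>\<psi>\<close> from
  \<open>B' - B\<close>. The sum map is onto because \<open>B'\<close> spans, and one-to-one by
  counting.\<close>

lemma subspace_splitting:
  fixes W :: "('a::{field,finite} ^ ('d::finite + 't::finite)) set"
  assumes W: "vec.subspace W" "vec.dim W = CARD('d)"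
  obtains \<phi> :: "'a ^ 'd \<Rightarrow> 'a ^ ('d + 't)" and \<psi> :: "'a ^ 't \<Rightarrow> 'a ^ ('d + 't)"
  where "vlin \<phi>" "vlin \<psi>" "range \<phi> = W" "bij (\<lambda>(w, u). \<phi> w + \<psi> u)"
proof -
  obtain B where B: "B \<subseteq> W" "vec.independent B" "W \<subseteq> vec.span B" "card B = CARD('d)"
    using vec.basis_exists[of W] W(2) by metis
  have spB: "vec.span B = W" using B W(1) by (metis subset_antisym vec.span_minimal)
  obtain B' where B': "B \<subseteq> B'" "vec.independent B'" "UNIV \<subseteq> vec.span B'"
    using vec.maximal_independent_subset_extend[OF subset_UNIV B(2)] by metis
  have spB': "vec.span B' = UNIV" using B'(3) by auto
  have "card B' = CARD('d) + CARD('t)"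
    using vec.dim_span_eq_card_independent[OF B'(2)] spB' vec_dim_card[where 'a='a and 'n="'d + 't"] by simp
  then have "card (B' - B) = CARD('t)" using B(4) B'(1) by (simp add: card_Diff_subset)
  then obtain e2 where e2: "bij_betw e2 (UNIV :: 't set) (B' - B)"
    by (metis finite finite_same_card_bij)
  obtain e1 where e1: "bij_betw e1 (UNIV :: 'd set) B" using B(4) by (metis finite finite_same_card_bij)
  define \<phi> :: "'a ^ 'd \<Rightarrow> 'a ^ ('d + 't)" where "\<phi> w = (\<Sum>i\<in>UNIV. w $ i *s e1 i)" for w
  define \<psi> :: "'a ^ 't \<Rightarrow> 'a ^ ('d + 't)" where "\<psi> u = (\<Sum>j\<in>UNIV. u $ j *s e2 j)" for u
  have lin: "vlin \<phi>" "vlin \<psi>"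
    unfolding \<phi>_def \<psi>_def by (intro vlinI; simp add: vec.scale_left_distrib sum.distrib vec.scale_sum_right)+
  have sum1: "(\<Sum>b\<in>B. c b *s b) = \<phi> (\<chi> i. c (e1 i))" for c
    unfolding \<phi>_def using sum.reindex_bij_betw[OF e1, of "\<lambda>b. c b *s b"] by simp
  have sum2: "(\<Sum>b\<in>B' - B. c b *s b) = \<psi> (\<chi> j. c (e2 j))" for c
    unfolding \<psi>_def using sum.reindex_bij_betw[OF e2, of "\<lambda>b. c b *s b"] by simp
  have "range \<phi> = W"
  proof
    have "e1 i \<in> W" for i using e1 B(1) by (auto simp: bij_betw_def)
    then show "range \<phi> \<subseteq> W"
      unfolding \<phi>_def by (auto intro!: vec.subspace_sum[OF W(1)] vec.subspace_scale[OF W(1)])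
    show "W \<subseteq> range \<phi>" using spB vec.span_finite[of B] sum1 by auto
  qed
  moreover have "bij (\<lambda>(w, u). \<phi> w + \<psi> u)"
  proof -
    let ?\<Phi> = "\<lambda>(w, u). \<phi> w + \<psi> u"
    have "x \<in> range ?\<Phi>" for x
    proof -
      have "x \<in> range (\<lambda>c. \<Sum>b\<in>B'. c b *s b)" using spB' vec.span_finite[of B'] by simp
      then obtain c where "x = (\<Sum>b\<in>B'. c b *s b)" by auto
      then have "x = (\<Sum>b\<in>B' - B. c b *s b) + (\<Sum>b\<in>B. c b *s b)" using sum.subset_diff[OF B'(1)] by simp
      then have "x = ?\<Phi> (\<chi> i. c (e1 i), \<chi> j. c (e2 j))" by (simp add: sum1 sum2 add.commute)
      then show ?thesis by blast
    qed
    then have "surj ?\<Phi>" by auto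
    moreover have "card (range ?\<Phi>) = CARD(('a ^ 'd) \<times> ('a ^ 't))"
      unfolding \<open>surj ?\<Phi>\<close> by (simp add: power_add)
    then have "inj ?\<Phi>" by (intro eq_card_imp_inj_on) simp_all
    ultimately show ?thesis by (simp add: bij_def)
  qed
  ultimately show thesis using that lin by blast
qed

theorem theorem1p3:
  fixes f :: "'p::prime_card mod_ring ^ 't::finite \<Rightarrow> 'p mod_ring ^ 't"
    and \<gamma> :: "nat \<Rightarrow> nat \<Rightarrow> nat multiset"
  assumes "complete_mapping f"
    and "\<And>l i. l \<in> {1..CARD('p) ^ CARD('t)} \<Longrightarrow> i \<in> {1..count (cycle_type f UNIV) l} \<Longrightarrow>
           \<gamma> l i \<in> Gamma TYPE('p mod_ring ^ 'd::finite) l"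
  shows "\<forall>W :: ('p mod_ring ^ ('d + 't)) set. vec.subspace W \<and> vec.dim W = CARD('d) \<longrightarrow>
           (\<exists>g. complete_mapping g \<and> coset_wise_affine W g \<and>
              cycle_type g UNIV =
                (\<Sum>l\<in>{1..CARD('p) ^ CARD('t)}. \<Sum>i\<in>{1..count (cycle_type f UNIV) l}. BU l (\<gamma> l i)))"
proof (intro allI impI, elim conjE)
  fix W :: "('p mod_ring ^ ('d + 't)) set"
  assume W: "vec.subspace W" "vec.dim W = CARD('d)"
  have f: "inj f" "inj (\<lambda>x. f x + x)" using assms(1) by (auto simp: complete_mapping_def bij_def)
  let ?O = "range (orbit_of f)"
  \<comment> \<open>\<open>\<iota>\<close> decides which \<open>\<gamma> l i\<close> is realized
    over the cycle \<open>Q\<close>.\<close>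
  obtain \<iota> where \<iota>: "\<And>Q. Q \<in> ?O \<Longrightarrow> card Q \<in> {1..CARD('p) ^ CARD('t)} \<and> \<iota> Q \<in> {1..count (cycle_type f UNIV) (card Q)}"
    and sum: "(\<Sum>Q\<in>?O. BU (card Q) (\<gamma> (card Q) (\<iota> Q))) =
      (\<Sum>l\<in>{1..CARD('p) ^ CARD('t)}. \<Sum>i\<in>{1..count (cycle_type f UNIV) l}. BU l (\<gamma> l i))"
    using sum_over_cycles[OF f(1), of "\<lambda>l i. BU l (\<gamma> l i)"] by auto
  have "\<exists>As :: nat \<Rightarrow> 'p mod_ring ^ 'd \<Rightarrow> _. Q \<in> ?O \<longrightarrow> (\<forall>k. As k \<in> ACGL) \<and>
      cycle_type (iter_comp As (card Q)) UNIV = \<gamma> (card Q) (\<iota> Q)" for Q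
    using Gamma_realization[OF assms(2)] \<iota>[of Q] by (metis atLeastAtMost_iff)
  then obtain As :: "_ \<Rightarrow> nat \<Rightarrow> 'p mod_ring ^ 'd \<Rightarrow> _"
    where As: "\<And>Q k. Q \<in> ?O \<Longrightarrow> As Q k \<in> ACGL"
      and ct: "\<And>Q. Q \<in> ?O \<Longrightarrow> cycle_type (iter_comp (As Q) (card Q)) UNIV = \<gamma> (card Q) (\<iota> Q)"
    by metis
  have "\<exists>A :: _ \<Rightarrow> 'p mod_ring ^ 'd \<Rightarrow> _. (\<forall>u. A u \<in> ACGL) \<and> cycle_type (\<lambda>(w, u). (A u w, f u)) UNIV =
      (\<Sum>Q\<in>?O. BU (card Q) (cycle_type (iter_comp (As Q) (card Q)) UNIV))"
    by (rule skew_product_realization[OF f(1)]) (simp_all add: As ACGL_D(1))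
  then obtain A :: "_ \<Rightarrow> 'p mod_ring ^ 'd \<Rightarrow> _" where A: "\<forall>u. A u \<in> ACGL"
    and ctA: "cycle_type (\<lambda>(w, u). (A u w, f u)) UNIV =
      (\<Sum>Q\<in>?O. BU (card Q) (cycle_type (iter_comp (As Q) (card Q)) UNIV))"
    by (elim exE conjE)
  note A = A[rule_format]
  obtain \<phi> :: "'p mod_ring ^ 'd \<Rightarrow> 'p mod_ring ^ ('d + 't)" and \<psi> :: "'p mod_ring ^ 't \<Rightarrow> 'p mod_ring ^ ('d + 't)"
    where \<phi>: "vlin \<phi>" "range \<phi> = W" and \<psi>: "vlin \<psi>" and bij: "bij (\<lambda>(w, u). \<phi> w + \<psi> u)"
    using subspace_splitting[OF W] by metis
  define \<Phi> where "\<Phi> = (\<lambda>(w, u). \<phi> w + \<psi> u)"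
  have \<Phi>: "inj \<Phi>" "surj \<Phi>" using bij by (simp_all add: \<Phi>_def bij_def)
  define \<tau> where "\<tau> x = inv_into UNIV \<Phi> x" for x
  have \<tau>\<Phi>: "\<tau> (\<Phi> z) = z" and \<Phi>\<tau>: "\<Phi> (\<tau> x) = x" for z x
    by (simp_all add: \<tau>_def inv_f_f[OF \<Phi>(1)] surj_f_inv_f[OF \<Phi>(2)])
  have \<tau>_eq: "\<tau> (\<phi> w + \<psi> u) = (w, u)" for w u using \<tau>\<Phi>[of "(w, u)"] by (simp add: \<Phi>_def)
  have dec: "\<exists>w u. x = \<phi> w + \<psi> u" for x
    using \<Phi>\<tau>[of x] by (cases "\<tau> x") (auto simp: \<Phi>_def)
  define G where "G = (\<lambda>(w, u). (A u w, f u))"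
  \<comment> \<open>The skew product \<open>G\<close>, transported to the vector space by
    \<open>\<Phi>\<close>.\<close>
  define g where "g x = \<Phi> (G (\<tau> x))" for x
  have g_eq: "g (\<phi> w + \<psi> u) = \<phi> (A u w) + \<psi> (f u)" for w u
    by (simp add: g_def \<tau>_eq G_def \<Phi>_def)
  have inj_eq: "w = w' \<and> u = u'" if "\<phi> w + \<psi> u = \<phi> w' + \<psi> u'" for w w' u u'
    using \<tau>_eq that by (metis prod.inject)
  have "inj g"
  proof (rule injI)
    fix x y assume gxy: "g x = g y"
    obtain w u w' u' where xy: "x = \<phi> w + \<psi> u" "y = \<phi> w' + \<psi> u'" using dec by metis
    have "A u w = A u' w' \<and> f u = f u'" using gxy unfolding xy g_eq by (rule inj_eq)
    then show "x = y" using f(1) ACGL_D(1)[OF A] xy by (metis injD)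
  qed
  moreover have "inj (\<lambda>x. g x + x)"
  proof (rule injI)
    fix x y assume gxy: "g x + x = g y + y"
    obtain w u w' u' where xy: "x = \<phi> w + \<psi> u" "y = \<phi> w' + \<psi> u'" using dec by metis
    \<comment> \<open>Adding the identity to \<open>g\<close> gives again a skew product, over
      \<open>f u + u\<close> and with fibre maps \<open>A u w + w\<close>.\<close>
    have "\<phi> (A u w + w) + \<psi> (f u + u) = \<phi> (A u' w' + w') + \<psi> (f u' + u')"
      using gxy unfolding xy g_eq by (simp add: vec.linear_add[OF \<phi>(1)] vec.linear_add[OF \<psi>] algebra_simps)
    then have "A u w + w = A u' w' + w' \<and> f u + u = f u' + u'" by (rule inj_eq)
    then show "x = y" using injD[OF f(2), of u u'] injD[OF ACGL_D(2)[OF A], of u w w'] xy by auto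
  qed
  ultimately have "complete_mapping g"
    unfolding complete_mapping_def bij_def using finite_UNIV_inj_surj[OF finite] by blast
  moreover have "coset_wise_affine W g"
    unfolding coset_wise_affine_def
  proof (intro ballI, clarify)
    fix x
    obtain w0 u where x: "x = \<phi> w0 + \<psi> u" using dec by blast
    obtain M v where Au: "A u = lam M v" using A[of u] by (auto simp: ACGL_def)
    \<comment> \<open>The linear part \<open>M\<close> of \<open>A u\<close>, extended by 0 on the
      range of \<open>\<psi>\<close>; on the coset over \<open>u\<close> the rest of
      \<open>g\<close> is the constant \<open>\<phi> v + \<psi> (f u)\<close>.\<close>
    define \<theta> where "\<theta> y = \<phi> (fst (\<tau> y) v* M)" for y
    have \<theta>_eq: "\<theta> (\<phi> w + \<psi> u') = \<phi> (w v* M)" for w u' by (simp add: \<theta>_def \<tau>_eq)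
    have "vlin \<theta>"
    proof (rule vlinI)
      fix y z
      obtain w u w' u' where yz: "y = \<phi> w + \<psi> u" "z = \<phi> w' + \<psi> u'" using dec by metis
      have "y + z = \<phi> (w + w') + \<psi> (u + u')"
        by (simp add: yz vec.linear_add[OF \<phi>(1)] vec.linear_add[OF \<psi>] algebra_simps)
      then have "\<theta> (y + z) = \<phi> ((w + w') v* M)" by (simp only: \<theta>_eq)
      then show "\<theta> (y + z) = \<theta> y + \<theta> z"
        by (simp only: yz \<theta>_eq vector_matrix_left_distrib vec.linear_add[OF \<phi>(1)])
    next
      fix c y
      obtain w u where y: "y = \<phi> w + \<psi> u" using dec by metis
      have "c *s y = \<phi> (c *s w) + \<psi> (c *s u)"
        by (simp add: y vec.linear_scale[OF \<phi>(1)] vec.linear_scale[OF \<psi>] vec.scale_right_distrib)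
      then have "\<theta> (c *s y) = \<phi> ((c *s w) v* M)" by (simp only: \<theta>_eq)
      then show "\<theta> (c *s y) = c *s \<theta> y"
        by (simp only: y \<theta>_eq scalar_vector_matrix_assoc vec.linear_scale[OF \<phi>(1)])
    qed
    moreover have "\<theta> ` W \<subseteq> W" using \<phi>(2) by (auto simp: \<theta>_def)
    moreover have "g y = \<theta> y + (\<phi> v + \<psi> (f u))" if y: "y \<in> (+) x ` W" for y
    proof -
      obtain w1 where "y = x + \<phi> w1" using y \<phi>(2) by auto
      then have "y = \<phi> (w0 + w1) + \<psi> u" by (simp add: x vec.linear_add[OF \<phi>(1)] ac_simps)
      then have "g y = \<phi> ((w0 + w1) v* M + v) + \<psi> (f u)" "\<theta> y = \<phi> ((w0 + w1) v* M)"
        by (simp_all only: g_eq \<theta>_eq Au lam_def)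
      then show ?thesis by (simp only: vec.linear_add[OF \<phi>(1)] add.assoc)
    qed
    ultimately show "\<exists>v \<phi>. vlin \<phi> \<and> \<phi> ` W \<subseteq> W \<and> (\<forall>y\<in>(+) x ` W. g y = \<phi> y + v)" by blast
  qed
  moreover have "cycle_type g UNIV =
      (\<Sum>l\<in>{1..CARD('p) ^ CARD('t)}. \<Sum>i\<in>{1..count (cycle_type f UNIV) l}. BU l (\<gamma> l i))"
  proof -
    have "cycle_type g (range \<Phi>) = cycle_type G UNIV"
      by (rule cycle_type_conj[OF \<Phi>(1)]) (simp add: g_def \<tau>\<Phi>)
    then have "cycle_type g UNIV = cycle_type G UNIV" using \<Phi>(2) by simp
    also have "\<dots> = (\<Sum>Q\<in>?O. BU (card Q) (\<gamma> (card Q) (\<iota> Q)))"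
      unfolding G_def ctA by (intro sum.cong) (simp_all add: ct)
    finally show ?thesis using sum by simp
  qed
  ultimately show "\<exists>g. complete_mapping g \<and> coset_wise_affine W g \<and> cycle_type g UNIV =
      (\<Sum>l\<in>{1..CARD('p) ^ CARD('t)}. \<Sum>i\<in>{1..count (cycle_type f UNIV) l}. BU l (\<gamma> l i))" by blast
qed

end
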